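(* Let $k$ and $\ell$ be positive integers with $\gcd(2k,\ell)=1$, and write $q:=2^k$, $Q:=2^\ell$ and $u:=(Q^{k+1}-1)/(Q-1)$. Let $a\in\mathbb{F}_{q^2}^*$ and $b\in\mathbb{F}_q^*$ with $a+b\ne 1$. Then $f(X):=X+bX^q+aX^u$ permutes $\mathbb{F}_{q^2}$ if and only if there exist $\lambda\in\mathbb{F}_q$ and $\epsilon\in\mathbb{F}_2$ such that all of the following hold: (1) $\lambda^{Q-1}=b$; (2) $a=\epsilon\lambda^Q+\sum_{i=1}^{\ell}\lambda^{Q-2^i}$; (3) $\mathrm{Tr}_{\mathbb{F}_q/\mathbb{F}_2}\bigl(\frac{a}{a+b+1}\bigr)=0$.
   Context: A polynomial permutes $\mathbb{F}_{q^2}$ if it induces a bijection of $\mathbb{F}_{q^2}$. $\mathrm{Tr}_{\mathbb{F}_q/\mathbb{F}_2}$ denotes the polynomial $X+X^2+X^4+\dots+X^{q/2}$ (which on $\mathbb{F}_q$ is the trace map to $\mathbb{F}_2$); note that (2) forces $a\in\mathbb{F}_q$. *)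

theory Defs
  imports Complex_Main "HOL-Computational_Algebra.Polynomial"
begin

definition is_subfield :: "'a::field set \<Rightarrow> bool" where
  "is_subfield K \<longleftrightarrow>
     0 \<in> K \<and> 1 \<in> K \<and>
     (\<forall>x\<in>K. \<forall>y\<in>K. x + y \<in> K \<and> x - y \<in> K \<and> x * y \<in> K) \<and>
     (\<forall>x\<in>K. x \<noteq> 0 \<longrightarrow> inverse x \<in> K)"

text \<open>The ambient finite field is the whole type, so a polynomial over it permutes the field
  iff its evaluation map is a bijection of the type.\<close>
definition permutes_field :: "'a::field poly \<Rightarrow> bool" where
  "permutes_field f \<longleftrightarrow> bij (poly f)"

text \<open>\<open>X + X\<^sup>2 + X\<^sup>4 + \<dots> + X\<^bsup>q/2\<^esup>\<close> for \<open>q = 2 ^ k\<close>\<close>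
definition trace_poly :: "nat \<Rightarrow> 'a::field poly" where
  "trace_poly k = (\<Sum>i<k. monom 1 (2 ^ i))"

end

(*
  Write U for the group of x with x^q x = 1. Since gcd (2k, l) = 1, the map x |-> x^Q generates the
  Galois group of the field over F_2, and x^(Q^k) = x^q. For x nonzero, w = x^(1 + Q + ... + Q^(k-1))
  therefore lies in U, w^(Q-1) = x^(q-1), and f(x) = x (1 + b w^(Q-1) + a w^Q). Hence f permutes the
  field iff g = (w^Q + b w + a^q) / (a w^(Q+1) + b w^Q + w) is defined and injective on U.

  In the pencil num + c den the singular members belong to the roots c, 1/c of
  b c^2 + (1 + b^2 + a^q a) c + b, and each is a linear form in w^Q times a linear form in w. If c lies
  in U, injectivity forces the two factors to have the same root, so g is conjugate to w^(Q+1) (and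
  c = 1 is excluded by a + b \<noteq> 1). Otherwise g is conjugate to y^Q (E y + G) / (G^q y + E^q); if E and G
  are both nonzero, injectivity is refuted by counting the points off U with value in U. So g is
  conjugate to w^(Q-1) or w^(Q+1), and the parities for which these are injective are elementary.

  With z the root attached to c, the conditions become b lam = lam^Q and a lam = c + 1/c for
  lam = z + 1/z and c = z^(1-Q) or z^(Q+1). With y = 1/(z+1) one has 1/lam = y^2 + y, so the sum in
  (2) telescopes and a/(a+b+1) = eps + y + y^Q, whose trace decides between z in F_q and z in U.
*)
theory Submission
  imports Defs
begin

section \<open>Frobenius maps and traces in characteristic two\<close>

locale quadratic_extension =
  fixes k l q Q :: nat and ty :: "'a::{field,finite} itself"
  assumes k_pos: "k > 0" and l_pos: "l > 0" and coprime_2k_l: "coprime (2 * k) l"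
    and q_def: "q = 2 ^ k" and Q_def: "Q = 2 ^ l"
    and card_UNIV_q2: "card (UNIV :: 'a set) = q ^ 2"

text \<open>Multiplication by \<open>x\<close> permutes the nonzero elements, so it preserves their
  product.\<close>

lemma is_subfield_power_card:
  fixes K :: "'a::{field,finite} set"
  assumes K: "is_subfield K" and x: "x \<in> K"
  shows "x ^ card K = x"
proof (cases "x = 0")
  case True
  have "card K > 0" using x by (auto simp: card_gt_0_iff)
  with True show ?thesis by simp
next
  case False
  let ?P = "\<Prod>y\<in>K - {0}. y"
  have "(\<lambda>y. x * y) ` (K - {0}) \<subseteq> K - {0}"
    using K x False by (auto simp: is_subfield_def)
  moreover have inj: "inj_on (\<lambda>y. x * y) (K - {0})"
    using False by (auto simp: inj_on_def)
  ultimately have im: "(\<lambda>y. x * y) ` (K - {0}) = K - {0}"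
    by (simp add: endo_inj_surj)
  have "?P = (\<Prod>y\<in>K - {0}. x * y)"
    using prod.reindex[OF inj, of "\<lambda>y. y"] im by simp
  also have "\<dots> = x ^ card (K - {0}) * ?P" by (simp add: prod.distrib)
  finally have "x ^ card (K - {0}) = 1" by simp
  moreover have "card K = Suc (card (K - {0}))"
    using K by (intro card.remove) (auto simp: is_subfield_def)
  ultimately show ?thesis by simp
qed

definition tr :: "nat \<Rightarrow> 'a::field \<Rightarrow> 'a" where
  "tr n x = (\<Sum>i<n. x ^ 2 ^ i)"

lemma poly_trace_poly: "poly (trace_poly n) x = tr n x"
  by (simp add: trace_poly_def tr_def poly_sum poly_monom)

lemma degree_trace_poly:
  assumes "n > 0" shows "degree (trace_poly n :: 'a::field poly) = 2 ^ (n - 1)"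
    and "trace_poly n \<noteq> (0 :: 'a poly)"
proof -
  have c: "coeff (trace_poly n :: 'a poly) (2 ^ (n - 1)) = 1"
  proof -
    have "coeff (trace_poly n :: 'a poly) (2 ^ (n - 1)) = (\<Sum>i<n. if i = n - 1 then 1 else 0)"
      by (simp add: trace_poly_def coeff_sum)
    also have "\<dots> = 1" using assms by simp
    finally show ?thesis .
  qed
  have "degree (trace_poly n :: 'a poly) \<le> 2 ^ (n - 1)"
    unfolding trace_poly_def
    by (intro degree_sum_le) (auto simp: degree_monom_eq intro!: power_increasing)
  with le_degree[of "trace_poly n :: 'a poly" "2 ^ (n - 1)"] c
  show "degree (trace_poly n :: 'a poly) = 2 ^ (n - 1)" by simp
  show "trace_poly n \<noteq> (0 :: 'a poly)" using c by auto
qed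

context quadratic_extension
begin

lemma q_gt1: "q > 1" and Q_gt1: "Q > 1"
  using k_pos l_pos by (simp_all add: q_def Q_def del: One_nat_def)

lemma l_odd: "odd l"
  using coprime_2k_l coprime_common_divisor[of "2 * k" l 2] by auto

lemma power_q2: "x ^ (q ^ 2) = (x :: 'a)"
  using is_subfield_power_card[of "UNIV :: 'a set" x]
  by (simp add: is_subfield_def card_UNIV_q2)

lemma power_q_q [simp]: "(x ^ q) ^ q = (x :: 'a)"
  using power_q2[of x] by (simp add: power2_eq_square power_mult)

lemma two_eq_0: "(1 :: 'a) + 1 = 0"
proof -
  \<comment> \<open>An even exponent sends \<open>- 1\<close> to \<open>1\<close>, yet every element
    equals its own power \<open>q ^ 2\<close>.\<close>
  have "even (q ^ 2)" using k_pos by (simp add: q_def)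
  hence "(- 1 :: 'a) = 1" using power_q2[of "- 1"] by simp
  thus ?thesis by (metis add.right_inverse)
qed

lemma add_self [simp]: "x + x = (0 :: 'a)"
  using two_eq_0 by (metis distrib_left mult.right_neutral mult_zero_right)

lemma add_self_left [simp]: "x + (x + y) = (y :: 'a)"
  by (simp add: add.assoc[symmetric])

lemma two_zero [simp]: "(2 :: 'a) = 0"
  using two_eq_0 by (simp only: one_add_one)

lemma add_eq_0_iff2: "x + y = 0 \<longleftrightarrow> x = (y :: 'a)"
  by (metis add_self add_left_cancel)

lemma frob_add: "(x + y) ^ 2 ^ n = x ^ 2 ^ n + (y :: 'a) ^ 2 ^ n"
proof (induction n)
  case (Suc n)
  have sq: "(u + v) ^ 2 = u ^ 2 + (v :: 'a) ^ 2" for u v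
    by (simp add: power2_eq_square algebra_simps)
  show ?case by (simp only: power_Suc2 power_mult Suc sq)
qed simp

lemma add_power_q: "(x + y) ^ q = x ^ q + (y :: 'a) ^ q"
  and add_power_Q: "(x + y) ^ Q = x ^ Q + (y :: 'a) ^ Q"
  and add_power_2: "(x + y) ^ 2 = x ^ 2 + (y :: 'a) ^ 2"
  using frob_add[of x y k] frob_add[of x y l] frob_add[of x y 1] by (simp_all add: q_def Q_def)

lemma sum_power_2: "(\<Sum>i\<in>A. f i) ^ 2 ^ n = (\<Sum>i\<in>A. f i ^ 2 ^ n :: 'a)"
  by (induction A rule: infinite_finite_induct) (simp_all add: frob_add)

lemma tr_add: "tr n (x + y) = tr n x + tr n (y :: 'a)"
  by (simp add: tr_def frob_add sum.distrib)

lemma tr_power: "tr n (x ^ 2 ^ m) = (tr n (x :: 'a)) ^ 2 ^ m"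
  by (simp add: tr_def sum_power_2 power_mult[symmetric] mult.commute)

text \<open>Squaring shifts each term to the next, so only the two end terms survive.\<close>

lemma tr_telescope: "tr n x ^ 2 + tr n x = x ^ 2 ^ n + (x :: 'a)"
proof (induction n)
  case 0 show ?case by (simp add: tr_def)
next
  case (Suc n)
  have "tr (Suc n) x ^ 2 + tr (Suc n) x = (tr n x ^ 2 + tr n x) + (x ^ 2 ^ n) ^ 2 + x ^ 2 ^ n"
    by (simp add: tr_def add_power_2 add_ac)
  also have "\<dots> = x ^ 2 ^ Suc n + x" unfolding Suc by (simp add: power_mult[symmetric] mult.commute add_ac)
  finally show ?case .
qed

lemma iterate_frob: "x ^ 2 ^ n = x \<Longrightarrow> x ^ 2 ^ (n * m) = (x :: 'a)"
  by (induction m) (simp_all add: power_add power_mult)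

text \<open>Such an \<open>x\<close> is a primitive cube root of unity, so it lies in the field of
  four elements.\<close>

lemma frob_2_of_cube_root:
  assumes "x ^ 2 = x + (1 :: 'a)" shows "x ^ 2 ^ 2 = x"
proof -
  have "x ^ 2 ^ 2 = (x ^ 2) ^ 2" by (simp flip: power_mult)
  also have "\<dots> = x" unfolding assms add_power_2 by (simp add: assms)
  finally show ?thesis .
qed

lemma frob_odd_of_cube_root:
  assumes "x ^ 2 = x + (1 :: 'a)" "odd n"
  shows "x ^ 2 ^ n = x + 1"
proof -
  obtain j where "n = 2 * j + 1" using \<open>odd n\<close> by (elim oddE)
  hence "x ^ 2 ^ n = (x ^ 2 ^ (2 * j)) ^ 2" by (simp add: power_mult[symmetric] mult.commute)
  thus ?thesis unfolding iterate_frob[OF frob_2_of_cube_root[OF assms(1)]] assms(1) .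
qed

text \<open>By Bezout some multiple of \<open>n\<close> is a multiple of \<open>m\<close> plus the
  gcd; iterating both hypotheses leaves only the gcd.\<close>

lemma frob_gcd:
  assumes "x ^ 2 ^ n = x" "x ^ 2 ^ m = x" "n > 0"
  shows "x ^ 2 ^ gcd n m = (x :: 'a)"
proof -
  obtain u v where "n * u = m * v + gcd n m" using bezout_nat[of n m] assms(3) by auto
  hence "x = x ^ 2 ^ (m * v + gcd n m)" using iterate_frob[OF assms(1), of u] by simp
  also have "\<dots> = (x ^ 2 ^ (m * v)) ^ 2 ^ gcd n m" by (simp add: power_add power_mult)
  also have "\<dots> = x ^ 2 ^ gcd n m" using iterate_frob[OF assms(2), of v] by simp
  finally show ?thesis by simp
qed

section \<open>Consequences of coprimality: fixed points and additive Hilbert 90\<close>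

lemma frob_2k: "x ^ 2 ^ (2 * k) = (x :: 'a)"
  using power_q2[of x] by (simp add: q_def power_mult[symmetric] mult.commute)

lemma square_fixed: "x ^ 2 = x \<Longrightarrow> x = 0 \<or> x = (1 :: 'a)"
  by (simp add: power2_eq_square)

lemma frob_fixed:
  assumes "coprime n (2 * k)" "x ^ 2 ^ n = (x :: 'a)"
  shows "x = 0 \<or> x = 1"
  using frob_gcd[OF frob_2k assms(2)] k_pos assms(1)
  by (intro square_fixed) (simp add: gcd.commute coprime_iff_gcd_eq_1)

lemma fixed_Q: "x ^ Q = x \<Longrightarrow> x = 0 \<or> x = (1 :: 'a)"
  using frob_fixed[of l x] coprime_2k_l by (simp add: Q_def coprime_commute)

text \<open>The quotient \<open>x / y\<close> is fixed by the \<open>Q\<close>-power, hence lies in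
  F_2. So the power \<open>Q - 1\<close> determines a nonzero element, which is the recurring
  uniqueness argument.\<close>

lemma power_Q_cross:
  assumes "x ^ Q * y = y ^ Q * x" "x \<noteq> 0" "y \<noteq> (0 :: 'a)"
  shows "x = y"
proof -
  have "(x / y) ^ Q = x / y" using assms by (simp add: power_divide field_simps)
  with fixed_Q[of "x / y"] assms show ?thesis by auto
qed

text \<open>Additive Hilbert 90 by counting: the kernel of \<open>f\<close> is F_2, so its image has
  at least half of all elements; it lies among the zeros of the trace, of which there are at most
  that many.\<close>

lemma artin_schreier:
  assumes "coprime n (2 * k)" "tr (2 * k) x = (0 :: 'a)"
  shows "\<exists>y. y ^ 2 ^ n + y = x"
proof -
  define f where "f y = y ^ 2 ^ n + y" for y :: 'a
  let ?Z = "{x :: 'a. poly (trace_poly (2 * k)) x = 0}"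
  have sub: "range f \<subseteq> ?Z"
  proof safe
    fix y :: 'a
    have "tr (2 * k) y ^ 2 = tr (2 * k) y"
      using tr_telescope[of "2 * k" y] frob_2k[of y] by (simp add: add_eq_0_iff2)
    \<comment> \<open>The trace lies in F_2, so every Frobenius power fixes it.\<close>
    hence "tr (2 * k) y ^ 2 ^ n = tr (2 * k) y" using square_fixed by fastforce
    thus "poly (trace_poly (2 * k)) (f y) = 0"
      by (simp add: poly_trace_poly f_def tr_add tr_power)
  qed
  have "finite ?Z" by simp
  have cZ: "card ?Z \<le> 2 ^ (2 * k - 1)"
    using card_poly_roots_bound[of "trace_poly (2 * k) :: 'a poly"] degree_trace_poly[of "2 * k", where 'a='a] k_pos
    by simp
  have fib: "card {y. f y = v} \<le> 2" for v
  proof (cases "\<exists>y. f y = v")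
    case True
    then obtain y0 where y0: "f y0 = v" by auto
    have "{y. f y = v} \<subseteq> {y0, y0 + 1}"
    proof
      fix y assume "y \<in> {y. f y = v}"
      hence "f y = f y0" using y0 by simp
      hence "y ^ 2 ^ n + y + (y0 ^ 2 ^ n + y0) = 0" by (simp add: f_def)
      hence "(y + y0) ^ 2 ^ n + (y + y0) = 0" by (simp add: frob_add add_ac)
      hence "(y + y0) ^ 2 ^ n = y + y0" by (simp only: add_eq_0_iff2)
      hence "y + y0 = 0 \<or> y + y0 = 1" using frob_fixed[OF assms(1)] by blast
      thus "y \<in> {y0, y0 + 1}" by (metis add_eq_0_iff2 add.commute add_self_left insertCI)
    qed
    from card_mono[OF _ this] have "card {y. f y = v} \<le> card {y0, y0 + 1}" by simp
    also have "\<dots> \<le> 2" by (simp add: card_insert_if)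
    finally show ?thesis .
  qed auto
  have "(UNIV :: 'a set) = (\<Union>v\<in>range f. {y. f y = v})" by auto
  hence "q ^ 2 \<le> (\<Sum>v\<in>range f. card {y. f y = v})"
    using card_UN_le[of "range f" "\<lambda>v. {y. f y = v}"] card_UNIV_q2 by simp
  also have "\<dots> \<le> (\<Sum>v\<in>range f. 2)" by (intro sum_mono fib)
  finally have "q ^ 2 \<le> 2 * card (range f)" by simp
  moreover have "q ^ 2 = 2 * 2 ^ (2 * k - 1)"
    using k_pos by (simp add: q_def power_mult[symmetric] mult.commute flip: power_Suc)
  ultimately have "card ?Z \<le> card (range f)" using cZ by linarith
  hence "range f = ?Z" by (rule card_seteq[OF \<open>finite ?Z\<close> sub])
  moreover have "x \<in> ?Z" using assms(2) by (simp add: poly_trace_poly)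
  ultimately show ?thesis by (force simp: f_def)
qed

text \<open>The upper half of the terms is the lower half evaluated at \<open>x ^ q\<close>.\<close>

lemma tr_double: "tr (2 * k) x = tr k (x + (x :: 'a) ^ q)"
proof -
  have "tr (m + n) x = tr m x + tr n (x ^ 2 ^ m)" for m n and x :: 'a
    by (induction n) (simp_all add: tr_def power_mult[symmetric] power_add[symmetric] add_ac)
  from this[of k k x] show ?thesis by (simp add: mult_2 tr_add q_def)
qed

text \<open>Since \<open>x + x ^ q = 0\<close>, the trace from the large field vanishes and a root
  exists; its conjugate is a root too, so the two differ by an element of F_2.\<close>

lemma quadratic_root:
  assumes "x ^ q = (x :: 'a)"
  obtains y where "y ^ 2 + y = x" "y ^ q = y \<or> y ^ q = y + 1"
proof -
  have "tr (2 * k) x = 0" unfolding tr_double using assms by (simp add: tr_def power_0_left)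
  then obtain y where y: "y ^ 2 ^ 1 + y = x" using artin_schreier[of 1 x] by auto
  have "(y ^ 2 + y) ^ q = y ^ 2 + y" using y assms by simp
  hence "(y ^ q) ^ 2 + y ^ q + (y ^ 2 + y) = 0"
    by (simp add: add_power_q power_mult[symmetric] mult.commute)
  hence "(y ^ q + y) ^ 2 + (y ^ q + y) = 0" by (simp add: add_power_2 add_ac)
  hence "y ^ q + y = 0 \<or> y ^ q + y = 1" by (intro square_fixed) (simp only: add_eq_0_iff2)
  hence "y ^ q = y \<or> y ^ q = y + 1" by (metis add_eq_0_iff2 add.commute add_self_left)
  with y that show thesis by auto
qed

lemma power_q_power_Q_commute: "(x ^ q) ^ Q = ((x :: 'a) ^ Q) ^ q"
  by (simp add: power_mult[symmetric] mult.commute)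

section \<open>A twisted fractional linear map on the unit circle\<close>

lemma zero_power_q [simp]: "(0 :: 'a) ^ q = 0" and zero_power_Q [simp]: "(0 :: 'a) ^ Q = 0"
  using q_gt1 Q_gt1 by (simp_all add: power_0_left)

text \<open>On nonzero elements the power \<open>Q - 1\<close> is injective, hence onto by
  finiteness.\<close>

lemma exists_power_Q_eq:
  assumes "v \<noteq> (0 :: 'a)" obtains y where "y \<noteq> 0" "y ^ Q = v * y"
proof -
  let ?f = "\<lambda>y :: 'a. y ^ Q / y"
  have "inj_on ?f (UNIV - {0})"
  proof (rule inj_onI)
    fix x y :: 'a assume "x \<in> UNIV - {0}" "y \<in> UNIV - {0}" "x ^ Q / x = y ^ Q / y"
    thus "x = y" by - (rule power_Q_cross, simp_all add: frac_eq_eq)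
  qed
  moreover have "?f ` (UNIV - {0}) \<subseteq> UNIV - {0}" by auto
  ultimately have "?f ` (UNIV - {0}) = UNIV - {0}" by (simp add: endo_inj_surj)
  hence "v \<in> ?f ` (UNIV - {0})" using assms by simp
  then obtain y where "y \<noteq> 0" "v = y ^ Q / y" by blast
  thus thesis by (intro that[of y]) (simp_all add: nonzero_eq_divide_eq)
qed

lemma card_power_eq: "n > 0 \<Longrightarrow> card {x :: 'a. x ^ n = c} \<le> n"
proof -
  assume n: "n > 0"
  let ?p = "monom 1 n + [:c:] :: 'a poly"
  have deg: "degree ?p = n" using n by (subst degree_add_eq_left) (simp_all add: degree_monom_eq)
  hence "?p \<noteq> 0" using n by (metis degree_0 less_irrefl)
  moreover have "{x. x ^ n = c} = {x. poly ?p x = 0}"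
    by (auto simp: poly_monom add_eq_0_iff2)
  ultimately show ?thesis using card_poly_roots_bound[of ?p] deg by simp
qed

text \<open>The power \<open>q - 1\<close> sends the \<open>q ^ 2 - 1\<close> nonzero elements to
  the circle, with fibres of size at most \<open>q - 1\<close>.\<close>

lemma card_unit_circle: "card {x :: 'a. x ^ q * x = 1} \<ge> q + 1"
proof -
  let ?U = "{x :: 'a. x ^ q * x = 1}"
  have "(UNIV - {0} :: 'a set) \<subseteq> (\<Union>m\<in>?U. {x. x ^ (q - 1) = m})"
  proof
    fix x :: 'a assume "x \<in> UNIV - {0}"
    hence x: "x \<noteq> 0" by simp
    have "x ^ (q - 1) = x ^ q / x" using x q_gt1 by (simp add: power_diff)
    hence "(x ^ (q - 1)) ^ q * x ^ (q - 1) = 1" using x by (simp add: power_divide)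
    thus "x \<in> (\<Union>m\<in>?U. {x. x ^ (q - 1) = m})" by simp
  qed
  from card_mono[OF _ this] have "card (UNIV - {0} :: 'a set) \<le> card (\<Union>m\<in>?U. {x. x ^ (q - 1) = m})"
    by simp
  also have "\<dots> \<le> (\<Sum>m\<in>?U. card {x. x ^ (q - 1) = m})" by (rule card_UN_le) simp
  also have "\<dots> \<le> (\<Sum>m\<in>?U. q - 1)" using q_gt1 by (intro sum_mono card_power_eq) simp
  finally have le: "q ^ 2 - 1 \<le> card ?U * (q - 1)" by (simp add: card_Diff_singleton card_UNIV_q2)
  have "q ^ 2 - 1 = (q + 1) * (q - 1)"
    by (simp add: power2_eq_square diff_mult_distrib2 add_mult_distrib)
  with le have "(q + 1) * (q - 1) \<le> card ?U * (q - 1)" by linarith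
  thus ?thesis using q_gt1 by (subst (asm) mult_le_cancel2) auto
qed

text \<open>In the coordinate \<open>Y = x0 / (x + x0)\<close> the equation for a further point \<open>x\<close> with the same
  value as \<open>x0\<close> becomes \<open>d Y\<^sup>Q + nu Y = E M\<close> with \<open>d\<close> and \<open>nu\<close> in the
  subfield of order \<open>q\<close>, and the trace obstruction to solving it vanishes.\<close>
lemma unit_circle_other_roots:
  fixes E G x0 :: 'a
  defines "A \<equiv> \<lambda>x. E * x + G" and "B \<equiv> \<lambda>x. G ^ q * x + E ^ q"
  assumes E: "E \<noteq> 0" and EG: "E ^ q * E \<noteq> G ^ q * G" and x0: "x0 ^ q * x0 = 1" and Bx0: "B x0 \<noteq> 0"
  obtains Y y where "y \<noteq> 0" "Y \<noteq> 0" "Y \<noteq> y"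
    "\<And>Z x. Z \<in> {Y, Y + y} \<Longrightarrow> x = x0 + x0 / Z \<Longrightarrow> x ^ Q * A x * B x0 = x0 ^ Q * A x0 * B x"
proof -
  define M where "M = B x0"
  define nu where "nu = M ^ q * M"
  define d where "d = E ^ q * E + G ^ q * G"
  have x0s: "x0 * x0 ^ q = 1" "x0 * (x0 ^ q * c) = c" "x0 * (c * x0 ^ q) = c" for c
    using x0 by (simp_all add: mult_ac flip: mult.assoc)
  have M: "M \<noteq> 0" using Bx0 by (simp add: M_def)
  have nu: "nu \<noteq> 0" "nu ^ q = nu" using M by (simp_all add: nu_def power_mult_distrib mult.commute)
  have d: "d \<noteq> 0" "d ^ q = d"
    using EG by (simp_all add: d_def add_eq_0_iff2 add_power_q power_mult_distrib mult.commute)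
  have Mq: "M ^ q = G * x0 ^ q + E" by (simp add: M_def B_def add_power_q power_mult_distrib)
  \<comment> \<open>This scaling has \<open>d * y ^ Q = nu * y\<close>, so \<open>Y = y * Z\<close>
    turns \<open>d * Y ^ Q + nu * Y = E * M\<close> into \<open>Z ^ Q + Z = C\<close>.\<close>
  obtain y where y: "y \<noteq> 0" "y ^ Q = nu / d * y"
    using exists_power_Q_eq[of "nu / d"] nu d by auto
  \<comment> \<open>The conjugate solves the same equation, as \<open>nu / d\<close> lies in F_q,
    and nonzero solutions are unique.\<close>
  have yq: "y ^ q = y"
  proof (rule power_Q_cross)
    have "(y ^ q) ^ Q = nu / d * y ^ q"
      using y(2) nu d by (simp add: power_q_power_Q_commute power_mult_distrib power_divide)
    thus "(y ^ q) ^ Q * y = y ^ Q * y ^ q" using y(2) by (simp add: mult_ac)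
  qed (use y in auto)
  define C where "C = E * M / (nu * y)"
  have "E * M + (E * M) ^ q = nu + d"
    unfolding power_mult_distrib Mq nu_def d_def by (simp add: M_def B_def algebra_simps x0s)
  hence "C + C ^ q = (nu + d) / (nu * y)"
    using nu yq by (simp add: C_def power_divide power_mult_distrib flip: add_divide_distrib)
  also have "\<dots> = 1 / y + (1 / y) ^ Q" using y nu d by (simp add: power_divide field_simps)
  \<comment> \<open>\<open>C + C ^ q\<close> is \<open>1 / y\<close> plus its
    \<open>Q\<close>-power; the trace of \<open>1 / y\<close> from F_q lies in F_2, so the two
    contributions cancel.\<close>
  finally have "tr (2 * k) C = tr k (1 / y) + tr k ((1 / y) ^ 2 ^ l)"
    by (simp add: tr_double tr_add Q_def)
  also have "\<dots> = tr k (1 / y) + tr k (1 / y) ^ Q" by (simp add: tr_power Q_def)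
  also have "tr k (1 / y) ^ Q = tr k (1 / y)"
  proof -
    have "tr k (1 / y) ^ 2 = tr k (1 / y)"
      using tr_telescope[of k "1 / y"] yq by (simp add: power_divide add_eq_0_iff2 flip: q_def)
    thus ?thesis using square_fixed Q_gt1 by fastforce
  qed
  finally have "tr (2 * k) C = 0" by simp
  then obtain Z where "Z ^ Q + Z = C"
    using artin_schreier[of l C] coprime_2k_l by (auto simp: coprime_commute Q_def)
  hence Z: "(Z + e) ^ Q + (Z + e) = C" if "e \<in> {0, 1}" for e
    using that Q_gt1 by (auto simp: add_power_Q add_ac)
  have *: "d * (y * (Z + e)) ^ Q + nu * (y * (Z + e)) = E * M" if "e \<in> {0, 1}" for e
  proof -
    have yQ: "d * (y * W) ^ Q = nu * y * W ^ Q" for W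
      using d y by (simp add: power_mult_distrib)
    have "d * (y * (Z + e)) ^ Q + nu * (y * (Z + e)) = nu * y * ((Z + e) ^ Q + (Z + e))"
      unfolding yQ by (simp only: distrib_left mult.assoc)
    also have "\<dots> = nu * y * C" by (simp only: Z[OF that])
    also have "\<dots> = E * M" using nu y(1) by (simp add: C_def)
    finally show ?thesis .
  qed
  have EM: "E * M \<noteq> 0" using E M by simp
  show thesis
  proof (rule that)
    show "y \<noteq> 0" by fact
    show "y * Z \<noteq> 0"
    proof
      assume "y * Z = 0"
      with *[of 0] EM show False by simp
    qed
    show "y * Z \<noteq> y"
    proof
      assume "y * Z = y"
      hence "Z = 1" using y(1) by simp
      with *[of 1] EM show False by simp
    qed
    fix W x assume W: "W \<in> {y * Z, y * Z + y}" and x: "x = x0 + x0 / W"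
    have "W = y * (Z + 0) \<or> W = y * (Z + 1)" using W by (auto simp: algebra_simps)
    hence eq: "d * W ^ Q + nu * W = E * M" using *[of 0] *[of 1] by auto
    have Wnz: "W \<noteq> 0"
    proof
      assume "W = 0"
      with eq EM show False by simp
    qed
    have A0: "A x0 = x0 * M ^ q" by (simp add: Mq A_def algebra_simps x0s)
    have xQ: "x ^ Q = x0 ^ Q * (W ^ Q + 1) / W ^ Q"
      using Wnz by (simp add: x add_power_Q power_divide field_simps)
    have Ax: "A x = (A x0 * W + E * x0) / W" using Wnz by (simp add: A_def x field_simps)
    have Bx: "B x = (M * W + G ^ q * x0) / W" using Wnz by (simp add: B_def M_def x field_simps)
    have dd: "E * M + M ^ q * G ^ q * x0 = d"
      unfolding Mq d_def by (simp add: M_def B_def algebra_simps x0s)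
    \<comment> \<open>With denominators and the factor \<open>x0 ^ Q\<close> removed, the sum of the
      two sides is \<open>x0\<close> times the sum of the sides of \<open>eq\<close>.\<close>
    have "(W ^ Q + 1) * (A x0 * W + E * x0) * M + A x0 * (M * W + G ^ q * x0) * W ^ Q
      = x0 * (W ^ Q * (E * M + M ^ q * G ^ q * x0) + nu * W + E * M)"
      unfolding A0 nu_def by (simp add: algebra_simps)
    also have "\<dots> = x0 * ((d * W ^ Q + nu * W) + E * M)"
      unfolding dd by (simp only: mult.commute add.assoc)
    also have "\<dots> = 0" unfolding eq by simp
    finally have key: "(W ^ Q + 1) * (A x0 * W + E * x0) * M = A x0 * (M * W + G ^ q * x0) * W ^ Q"
      by (simp only: add_eq_0_iff2)
    have "x ^ Q * A x * B x0 = x0 ^ Q * ((W ^ Q + 1) * (A x0 * W + E * x0) * M) / (W ^ Q * W)"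
      unfolding xQ Ax M_def by simp
    also have "\<dots> = x0 ^ Q * A x0 * B x"
      unfolding key Bx using Wnz by simp
    finally show "x ^ Q * A x * B x0 = x0 ^ Q * A x0 * B x" .
  qed
qed

lemma power_Q_eq_iff [simp]: "x ^ Q = y ^ Q \<longleftrightarrow> x = (y :: 'a)"
proof
  assume "x ^ Q = y ^ Q"
  hence "(x + y) ^ Q = 0" by (simp add: add_power_Q)
  thus "x = y" by (simp add: add_eq_0_iff2)
qed simp

lemma power_Q_eq_1_iff [simp]: "x ^ Q = 1 \<longleftrightarrow> x = (1 :: 'a)"
  using power_Q_eq_iff[of x 1] by simp

text \<open>In characteristic two, equations whose sides have the same total are equivalent; what
  remains to check is a polynomial identity.\<close>

lemma eq_transfer: "x = y \<Longrightarrow> x + y = u + v \<Longrightarrow> u = (v :: 'a)"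
  using add_eq_0_iff2 by fastforce

lemma card_fixed_q: "card {p :: 'a. p ^ q = p} \<le> q"
proof -
  let ?r = "monom 1 q + [:0, 1:] :: 'a poly"
  have deg: "degree ?r = q"
    using q_gt1 by (subst degree_add_eq_left) (simp_all add: degree_monom_eq)
  hence "?r \<noteq> 0" using q_gt1 by (metis degree_0 not_less_zero)
  moreover have "{p :: 'a. p ^ q = p} = {p. poly ?r p = 0}"
    by (simp add: poly_monom add_eq_0_iff2)
  ultimately show ?thesis
    using card_poly_roots_bound[of ?r] deg by simp
qed

text \<open>If the map were injective, the two further points with the value of each point of the circle would all lie
  off the circle and number at least \<open>2 (q + 1)\<close>. But a point \<open>x\<close> off the circle whose value lies on
  it is one of at most two with the given norm \<open>p = x\<^sup>q x\<close>, and only \<open>q - 2\<close> norms are possible.\<close>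
lemma circle_map_not_injective:
  fixes E G :: 'a
  assumes E: "E \<noteq> 0" and G: "G \<noteq> 0" and EG: "E ^ q * E \<noteq> G ^ q * G"
  obtains x1 x2 where "x1 ^ q * x1 = 1" "x2 ^ q * x2 = 1" "x1 \<noteq> x2"
    "x1 ^ Q * (E * x1 + G) * (G ^ q * x2 + E ^ q) = x2 ^ Q * (E * x2 + G) * (G ^ q * x1 + E ^ q)"
proof -
  define A where "A x = E * x + G" for x
  define B where "B x = G ^ q * x + E ^ q" for x
  define U where "U = {x :: 'a. x ^ q * x = 1}"
  have conjA: "A x ^ q = E ^ q * x ^ q + G ^ q" and conjB: "B x ^ q = G * x ^ q + E" for x
    by (simp_all add: A_def B_def add_power_q power_mult_distrib)
  \<comment> \<open>A common zero would make the determinant \<open>E ^ q * E - G ^ q * G\<close>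
    vanish.\<close>
  have AB: "A x \<noteq> 0 \<or> B x \<noteq> 0" for x
  proof (rule ccontr)
    assume "\<not> ?thesis"
    hence "E * x = G" "G ^ q * x = E ^ q" by (simp_all add: A_def B_def add_eq_0_iff2)
    hence "E ^ q * E = G ^ q * G" by (metis mult.assoc mult.commute)
    with EG show False by simp
  qed
  \<comment> \<open>On the circle \<open>A x\<close> and \<open>B x\<close> are conjugate up to the
    factor \<open>x\<close>, so \<open>x ^ Q * A x / B x\<close> stays on the circle.\<close>
  have U: "x \<noteq> 0" "B x ^ q * x = A x" "A x ^ q * x = B x" if "x \<in> U" for x
  proof -
    have x: "x ^ q * x = 1" using that by (simp add: U_def)
    thus "x \<noteq> 0" by auto
    have "B x ^ q * x = G * (x ^ q * x) + E * x" "A x ^ q * x = E ^ q * (x ^ q * x) + G ^ q * x"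
      by (simp_all add: conjA conjB algebra_simps)
    thus "B x ^ q * x = A x" "A x ^ q * x = B x"
      by (simp_all only: x) (simp_all add: A_def B_def add.commute)
  qed
  have BU: "B x \<noteq> 0" "A x \<noteq> 0" if "x \<in> U" for x
    using U[OF that] AB[of x] by auto
  show thesis
  proof (rule ccontr)
    assume "\<not> thesis"
    with that have inj: "x1 = x2"
      if "x1 \<in> U" "x2 \<in> U" "x1 ^ Q * A x1 * B x2 = x2 ^ Q * A x2 * B x1" for x1 x2
      using that unfolding A_def B_def U_def by blast
    have "\<forall>x0\<in>U. \<exists>Y y. y \<noteq> 0 \<and> Y \<noteq> 0 \<and> Y \<noteq> y \<and> (\<forall>Z\<in>{Y, Y + y}.
      (x0 + x0 / Z) ^ Q * A (x0 + x0 / Z) * B x0 = x0 ^ Q * A x0 * B (x0 + x0 / Z))"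
    proof
      fix x0 assume x0: "x0 \<in> U"
      hence "x0 ^ q * x0 = 1" "G ^ q * x0 + E ^ q \<noteq> 0" using BU by (auto simp: U_def B_def)
      from unit_circle_other_roots[OF E EG this]
      show "\<exists>Y y. y \<noteq> 0 \<and> Y \<noteq> 0 \<and> Y \<noteq> y \<and> (\<forall>Z\<in>{Y, Y + y}.
        (x0 + x0 / Z) ^ Q * A (x0 + x0 / Z) * B x0 = x0 ^ Q * A x0 * B (x0 + x0 / Z))"
        unfolding A_def B_def by metis
    qed
    then obtain Y y where Yy: "\<And>x0. x0 \<in> U \<Longrightarrow> y x0 \<noteq> 0 \<and> Y x0 \<noteq> 0 \<and> Y x0 \<noteq> y x0"
      and rt: "\<And>x0 Z. x0 \<in> U \<Longrightarrow> Z \<in> {Y x0, Y x0 + y x0} \<Longrightarrow>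
        (x0 + x0 / Z) ^ Q * A (x0 + x0 / Z) * B x0 = x0 ^ Q * A x0 * B (x0 + x0 / Z)"
      by metis
    \<comment> \<open>The Boolean selects one of the two values of \<open>x0 / (x + x0)\<close>;
      \<open>g\<close> solves for \<open>x\<close>.\<close>
    define g where "g p = (let Z = (if snd p then Y (fst p) + y (fst p) else Y (fst p)) in fst p + fst p / Z)" for p
    define S where "S = {x. x \<noteq> 0 \<and> x ^ q * x \<noteq> 1 \<and>
      (x ^ q * x) ^ Q * (A x ^ q * A x) = B x ^ q * B x}"
    have g: "\<exists>Z\<in>{Y x0, Y x0 + y x0}. Z \<noteq> 0 \<and> g (x0, j) = x0 + x0 / Z" if "x0 \<in> U" for x0 j
      using Yy[OF that] by (auto simp: g_def add_eq_0_iff2)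
    have B0: "B x \<noteq> 0" if "x ^ Q * A x * B x0 = x0 ^ Q * A x0 * B x" "x0 \<in> U" for x x0
    proof
      assume "B x = 0"
      with that BU[of x0] AB[of x] have "x ^ Q = 0" by auto
      hence "x = 0" by simp
      with \<open>B x = 0\<close> E show False by (simp add: B_def)
    qed
    have gB: "g (x0, j) ^ Q * A (g (x0, j)) * B x0 = x0 ^ Q * A x0 * B (g (x0, j))"
      "B (g (x0, j)) \<noteq> 0" "g (x0, j) \<noteq> x0" if "x0 \<in> U" for x0 j
    proof -
      show *: "g (x0, j) ^ Q * A (g (x0, j)) * B x0 = x0 ^ Q * A x0 * B (g (x0, j))"
        using g[OF that, of j] rt[OF that] by auto
      show "B (g (x0, j)) \<noteq> 0" by (rule B0[OF * that])
      show "g (x0, j) \<noteq> x0" using g[OF that, of j] U[OF that] by auto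
    qed
    have "g ` (U \<times> UNIV) \<subseteq> S"
    proof (rule image_subsetI)
      fix p :: "'a \<times> bool" assume "p \<in> U \<times> UNIV"
      then obtain x0 j where p: "p = (x0, j)" and x0: "x0 \<in> U" by auto
      define x where "x = g (x0, j)"
      have eq: "x ^ Q * A x * B x0 = x0 ^ Q * A x0 * B x" and Bx: "B x \<noteq> 0" and ne: "x \<noteq> x0"
        using gB[OF x0, of j] by (simp_all add: x_def)
      have "x \<noteq> 0" using eq Bx BU[OF x0] U[OF x0] by auto
      moreover have "x \<notin> U" using inj[OF _ x0 eq] ne by auto
      hence "x ^ q * x \<noteq> 1" by (simp add: U_def)
      moreover have "(x ^ q * x) ^ Q * (A x ^ q * A x) = B x ^ q * B x"
      proof -
        have "(x ^ q * x) ^ Q * (A x ^ q * A x) * (B x0 ^ q * B x0)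
          = (x ^ Q * A x * B x0) ^ q * (x ^ Q * A x * B x0)"
          by (simp add: power_mult_distrib power_q_power_Q_commute mult_ac)
        also have "\<dots> = (x0 ^ q * x0) ^ Q * ((A x0 ^ q * A x0) * (B x ^ q * B x))"
          unfolding eq by (simp add: power_mult_distrib power_q_power_Q_commute mult_ac)
        also have "\<dots> = (B x ^ q * B x) * (A x0 ^ q * A x0)"
          using x0 by (simp add: U_def mult_ac)
        also have "A x0 ^ q * A x0 = B x0 ^ q * B x0"
          using U(2,3)[OF x0] by (metis mult.assoc mult.commute)
        finally show ?thesis using BU[OF x0] by simp
      qed
      ultimately show "g p \<in> S" by (simp add: S_def p x_def)
    qed
    \<comment> \<open>The value at \<open>x\<close> recovers \<open>x0\<close> by the assumed
      injectivity; then \<open>y x0 \<noteq> 0\<close> separates the two choices of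
      \<open>j\<close>.\<close>
    moreover have "inj_on g (U \<times> UNIV)"
    proof (rule inj_onI)
      fix p p' :: "'a \<times> bool" assume pp: "p \<in> U \<times> UNIV" "p' \<in> U \<times> UNIV" and eq: "g p = g p'"
      obtain x0 j x1 j' where p: "p = (x0, j)" "p' = (x1, j')" and x: "x0 \<in> U" "x1 \<in> U"
        using pp by auto
      define x where "x = g p"
      have x': "x = g (x0, j)" "x = g (x1, j')" using eq by (simp_all add: x_def p)
      have "x ^ Q * A x * B x0 = x0 ^ Q * A x0 * B x" "x ^ Q * A x * B x1 = x1 ^ Q * A x1 * B x"
        using gB(1)[OF x(1), of j] gB(1)[OF x(2), of j'] by (simp_all flip: x')
      note eqs = this
      have "(x0 ^ Q * A x0 * B x1) * B x = (x0 ^ Q * A x0 * B x) * B x1" by (simp only: mult_ac)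
      also have "\<dots> = (x ^ Q * A x * B x1) * B x0" unfolding eqs(1)[symmetric] by (simp only: mult_ac)
      also have "\<dots> = (x1 ^ Q * A x1 * B x0) * B x" unfolding eqs(2) by (simp only: mult_ac)
      finally have "(x0 ^ Q * A x0 * B x1) * B x = (x1 ^ Q * A x1 * B x0) * B x" .
      moreover have "B x \<noteq> 0" using gB(2)[OF x(1), of j] by (simp flip: x')
      ultimately have "x0 ^ Q * A x0 * B x1 = x1 ^ Q * A x1 * B x0" by simp
      with inj x have "x0 = x1" by blast
      moreover have "j = j'"
      proof (rule ccontr)
        assume "j \<noteq> j'"
        hence "x0 / Y x0 = x0 / (Y x0 + y x0)"
          using x' \<open>x0 = x1\<close> by (cases j; cases j') (auto simp: g_def)
        hence "Y x0 = Y x0 + y x0"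
          using U(1)[OF x(1)] Yy[OF x(1)] by (simp add: frac_eq_eq add_eq_0_iff2)
        with Yy[OF x(1)] show False by simp
      qed
      ultimately show "p = p'" by (simp add: p)
    qed
    ultimately have "card (U \<times> (UNIV :: bool set)) \<le> card S"
      by (metis card_image card_mono finite)
    hence lower: "2 * (q + 1) \<le> card S"
      using card_unit_circle by (simp add: card_cartesian_product U_def)
    define P where "P = {p :: 'a. p ^ q = p} - {0, 1}"
    define c where "c = E * G ^ q"
    \<comment> \<open>For \<open>x\<close> of norm \<open>p\<close>, the condition in
      \<open>S\<close> is linear in the relative trace \<open>s\<close> of \<open>c * x\<close>,
      with solution \<open>t p\<close>. Trace and norm then make \<open>c * x\<close> a root of a
      known quadratic.\<close>
    define t where "t p = (G ^ q * G * p + E ^ q * E + p ^ Q * (E ^ q * E * p + G ^ q * G)) / (p ^ Q + 1)" for p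
    have "card {x \<in> S. x ^ q * x = p} \<le> 2" if "p \<in> P" for p
    proof -
      have pQ: "p ^ Q \<noteq> 1"
        using that by (simp add: P_def)
      have "{x \<in> S. x ^ q * x = p} \<subseteq> {x. poly [:c ^ q * c * p, t p * c, c ^ 2:] x = 0}"
      proof safe
        fix x assume x: "x \<in> S" "p = x ^ q * x"
        define s where "s = c * x + (c * x) ^ q"
        have a: "A x ^ q * A x = E ^ q * E * p + G ^ q * G + s"
          and b: "B x ^ q * B x = G ^ q * G * p + E ^ q * E + s"
          unfolding conjA conjB s_def c_def x(2)
          by (simp_all add: A_def B_def power_mult_distrib algebra_simps)
        have "p ^ Q * (E ^ q * E * p + G ^ q * G + s) = G ^ q * G * p + E ^ q * E + s"
          using x(1) by (simp add: S_def x(2)[symmetric] a b)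
        hence "(p ^ Q + 1) * s = G ^ q * G * p + E ^ q * E + p ^ Q * (E ^ q * E * p + G ^ q * G)"
          by (rule eq_transfer) (simp add: algebra_simps)
        hence s: "s = t p" using pQ by (simp add: t_def nonzero_eq_divide_eq add_eq_0_iff2 mult.commute)
        have "(c * x) ^ 2 + s * (c * x) + (c * x) ^ q * (c * x) = 0"
          by (simp add: s_def power2_eq_square algebra_simps)
        thus "poly [:c ^ q * c * (x ^ q * x), t (x ^ q * x) * c, c ^ 2:] x = 0"
          by (simp add: s x(2) power2_eq_square power_mult_distrib algebra_simps)
      qed
      hence "card {x \<in> S. x ^ q * x = p} \<le> card {x. poly [:c ^ q * c * p, t p * c, c ^ 2:] x = 0}"
        by (intro card_mono) auto
      also have "\<dots> \<le> degree [:c ^ q * c * p, t p * c, c ^ 2:]"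
        using E G by (intro card_poly_roots_bound) (simp add: c_def)
      also have "\<dots> \<le> 2" by (simp add: degree_pCons_eq_if)
      finally show ?thesis .
    qed
    hence "(\<Sum>p\<in>P. card {x \<in> S. x ^ q * x = p}) \<le> (\<Sum>p\<in>P. 2)" by (rule sum_mono)
    moreover have "S \<subseteq> (\<Union>p\<in>P. {x \<in> S. x ^ q * x = p})"
      by (auto simp: S_def P_def power_mult_distrib mult.commute)
    hence "card S \<le> (\<Sum>p\<in>P. card {x \<in> S. x ^ q * x = p})"
      by (intro order.trans[OF card_mono card_UN_le]) auto
    moreover have "card P \<le> q - 2"
    proof -
      have "card P = card {p :: 'a. p ^ q = p} - card {0, 1 :: 'a}"
        unfolding P_def by (intro card_Diff_subset) auto
      thus ?thesis using card_fixed_q by simp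
    qed
    ultimately have "card S \<le> 2 * (q - 2)" by simp
    with lower show False by simp
  qed
qed

section \<open>Reduction to the unit circle\<close>

text \<open>With \<open>w = circ x\<close> and \<open>f\<close> the polynomial map,
  \<open>num a b w\<close> and \<open>den a b w\<close> are \<open>w / x\<close> times
  \<open>f x ^ q\<close> and \<open>f x\<close>, so their quotient is
  \<open>f x ^ (q - 1)\<close>.\<close>

definition num :: "'a \<Rightarrow> 'a \<Rightarrow> 'a \<Rightarrow> 'a" where
  "num a b x = x ^ Q + b * x + a ^ q"

definition den :: "'a \<Rightarrow> 'a \<Rightarrow> 'a \<Rightarrow> 'a" where
  "den a b x = a * x ^ Q * x + b * x ^ Q + x"

section \<open>The norm-one element attached to a nonzero element\<close>

lemma geometric_sum_Q: "(Q - 1) * (\<Sum>i<n. Q ^ i) + 1 = Q ^ n"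
proof (induction n)
  case (Suc n)
  have "(Q - 1) * (\<Sum>i<Suc n. Q ^ i) + 1 = Q ^ n + (Q - 1) * Q ^ n"
    using Suc by (simp add: distrib_left)
  also have "\<dots> = Q ^ Suc n" using Q_gt1 by (cases Q) simp_all
  finally show ?case .
qed simp

text \<open>As \<open>l\<close> is odd, \<open>Q ^ k\<close> is \<open>q\<close> times a power of
  \<open>2 ^ (2 * k)\<close>, and the latter acts trivially.\<close>

lemma power_Q_power_k: "x ^ Q ^ k = (x :: 'a) ^ q"
proof -
  obtain j where "l = 2 * j + 1" using l_odd by (elim oddE)
  hence "Q ^ k = 2 ^ (2 * k * j) * q"
    by (simp add: Q_def q_def power_mult[symmetric] algebra_simps flip: power_add)
  thus ?thesis using iterate_frob[OF frob_2k, of x j] by (simp add: power_mult)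
qed

text \<open>The exponent is \<open>(Q\<^sup>k - 1) / (Q - 1)\<close>, so \<open>circ x\<^bsup>Q-1\<^esup> = x\<^bsup>q-1\<^esup>\<close> and the exponent \<open>u\<close> of the
  theorem satisfies \<open>x\<^sup>u = circ x * x\<^sup>q\<close>.\<close>
definition circ :: "'a \<Rightarrow> 'a" where
  "circ x = x ^ (\<Sum>i<k. Q ^ i)"

lemma circ_mult: "circ (x * y) = circ x * circ y"
  by (simp add: circ_def power_mult_distrib)

lemma circ_0 [simp]: "circ 0 = 0"
proof -
  have "(\<Sum>i<k. Q ^ i) \<noteq> 0" using k_pos Q_gt1 by auto
  thus ?thesis by (simp add: circ_def power_0_left)
qed

lemma circ_eq_0_iff [simp]: "circ x = 0 \<longleftrightarrow> x = 0"
  using circ_0 by (auto simp: circ_def)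

lemma circ_power_Q: "circ x ^ Q * x = circ x * x ^ q"
proof -
  have "circ x ^ Q * x = circ x * (circ x ^ (Q - 1) * x)"
    using Q_gt1 by (simp add: power_eq_if)
  also have "circ x ^ (Q - 1) * x = x ^ ((Q - 1) * (\<Sum>i<k. Q ^ i) + 1)"
    by (simp add: circ_def power_mult[symmetric] mult.commute)
  also have "\<dots> = x ^ q" by (simp only: geometric_sum_Q power_Q_power_k)
  finally show ?thesis .
qed

lemma unit_circle_inverse: "w ^ q * w = 1 \<Longrightarrow> w \<noteq> 0" "w ^ q * w = 1 \<Longrightarrow> w ^ q = 1 / (w :: 'a)"
  by (auto simp: nonzero_eq_divide_eq) (auto simp: eq_divide_eq)

text \<open>Multiplying \<open>circ_power_Q\<close> by its conjugate shows that the norm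
  \<open>n\<close> satisfies \<open>n ^ Q = n\<close>, and it is nonzero.\<close>

lemma circ_unit: "circ x ^ q * circ x = 1" if "x \<noteq> 0"
proof -
  define n where "n = circ x ^ q * circ x"
  have "(circ x ^ Q) ^ q * x ^ q = (circ x ^ Q * x) ^ q" by (simp only: power_mult_distrib)
  also have "\<dots> = circ x ^ q * x" by (simp only: circ_power_Q power_mult_distrib power_q_q)
  finally have conj: "(circ x ^ Q) ^ q * x ^ q = circ x ^ q * x" .
  have "n ^ Q * (x ^ q * x) = ((circ x ^ Q) ^ q * x ^ q) * (circ x ^ Q * x)"
    by (simp only: n_def power_mult_distrib power_q_power_Q_commute mult_ac)
  also have "\<dots> = n * (x ^ q * x)"
    unfolding conj circ_power_Q by (simp only: n_def mult_ac)
  finally have "n ^ Q * (x ^ q * x) = n * (x ^ q * x)" .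
  hence "n ^ Q = n" using that by simp
  moreover have "n \<noteq> 0" using that by (simp add: n_def)
  ultimately show ?thesis using fixed_Q n_def by blast
qed

lemma circ_fixed: "circ r = 1" if "r ^ q = r" "r \<noteq> 0"
  using circ_power_Q[of r] fixed_Q[of "circ r"] that by simp

text \<open>It suffices to find \<open>x\<close> with \<open>x ^ (q - 1) = w ^ (Q - 1)\<close>,
  because the left side is also \<open>circ x ^ (Q - 1)\<close>.\<close>

lemma circ_surj:
  assumes "w ^ q * w = 1" obtains x where "x \<noteq> 0" "circ x = w"
proof -
  have w: "w \<noteq> 0" "w ^ q = 1 / w" using unit_circle_inverse[OF assms] by simp_all
  obtain x where x: "x \<noteq> 0" "x ^ q * w = w ^ Q * x"
  proof (cases "w = 1")
    case True thus thesis using that[of 1] by simp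
  next
    case False
    \<comment> \<open>On the circle \<open>(1 + v) ^ q = (1 + v) / v\<close>, so
      \<open>1 / (1 + v)\<close> has \<open>v\<close> as its power \<open>q - 1\<close>.\<close>
    define v where "v = w ^ Q / w"
    have v: "v \<noteq> 0" "v \<noteq> 1" using w False fixed_Q[of w] by (auto simp: v_def)
    have nz: "1 + v \<noteq> 0" using v by (auto simp: add_eq_0_iff2)
    have "v ^ q = 1 / v" using w
      by (simp add: v_def power_divide power_q_power_Q_commute[symmetric])
    hence "(1 + v) ^ q = (1 + v) / v" using v by (simp add: add_power_q add_divide_distrib)
    hence "(1 / (1 + v)) ^ q = v / (1 + v)" by (simp add: power_divide)
    moreover note nz
    ultimately show thesis using that[of "1 / (1 + v)"] w by (simp add: v_def)
  qed
  have "circ x ^ Q * w = w ^ Q * circ x"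
  proof -
    have "(circ x ^ Q * w) * x = circ x * (x ^ q * w)"
      using circ_power_Q[of x] by (simp add: mult_ac)
    also have "\<dots> = (w ^ Q * circ x) * x" unfolding x(2) by (simp only: mult_ac)
    finally have "(circ x ^ Q * w) * x = (w ^ Q * circ x) * x" .
    thus ?thesis using x(1) by simp
  qed
  hence "circ x = w" by (rule power_Q_cross) (use x w in auto)
  thus thesis using that x by blast
qed

text \<open>The map \<open>f\<close> commutes with scaling by nonzero elements of F_q, whose orbits
  on nonzero elements are the fibres of \<open>circ\<close>. Hence it is injective iff it has no
  nonzero zero and separates orbits, and \<open>num / den\<close> records the orbit of the
  value.\<close>

lemma permutes_field_iff:
  assumes b: "b ^ q = b" and u: "u = (Q ^ (k + 1) - 1) div (Q - 1)"
  shows "permutes_field (monom 1 1 + monom b q + monom a u) \<longleftrightarrow>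
    (\<forall>w. w ^ q * w = 1 \<longrightarrow> den a b w \<noteq> 0) \<and>
    (\<forall>w1 w2. w1 ^ q * w1 = 1 \<longrightarrow> w2 ^ q * w2 = 1 \<longrightarrow>
      num a b w1 * den a b w2 = num a b w2 * den a b w1 \<longrightarrow> w1 = w2)" (is "_ \<longleftrightarrow> ?D \<and> ?I")
proof -
  define f where "f x = x + b * x ^ q + a * (circ x * x ^ q)" for x
  have "(Q - 1) * (\<Sum>i<k + 1. Q ^ i) = Q ^ (k + 1) - 1"
    using geometric_sum_Q[of "k + 1"] by linarith
  hence "u = (\<Sum>i<k + 1. Q ^ i)" using Q_gt1 u
    by (metis nonzero_mult_div_cancel_left zero_less_diff less_numeral_extra(3))
  hence "poly (monom 1 1 + monom b q + monom a u) = f"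
    by (auto simp: fun_eq_iff poly_monom f_def circ_def power_add power_Q_power_k)
  hence perm: "permutes_field (monom 1 1 + monom b q + monom a u) \<longleftrightarrow> inj f"
    using finite_UNIV_inj_surj[of f] by (auto simp: permutes_field_def bij_def)
  have den: "circ x * f x = x * den a b (circ x)" for x
  proof -
    have "circ x * f x = circ x * x + b * (circ x * x ^ q) + a * (circ x * (circ x * x ^ q))"
      by (simp add: f_def algebra_simps)
    also have "\<dots> = x * den a b (circ x)"
      unfolding circ_power_Q[symmetric] by (simp add: den_def algebra_simps)
    finally show ?thesis .
  qed
  have num: "circ x * f x ^ q = x * num a b (circ x)" if "x \<noteq> 0" for x
  proof -
    have "circ x * f x ^ q = circ x * x ^ q + b * (circ x * x) + a ^ q * (circ x ^ q * circ x) * x"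
      by (simp add: f_def add_power_q power_mult_distrib b algebra_simps)
    also have "\<dots> = x * num a b (circ x)"
      unfolding circ_unit[OF that] circ_power_Q[symmetric] by (simp add: num_def algebra_simps)
    finally show ?thesis .
  qed
  have f0: "f 0 = 0" by (simp add: f_def)
  have scale: "f (r * x) = r * f x" if "r ^ q = r" "r \<noteq> 0" for r x
    using that by (simp add: f_def circ_mult circ_fixed power_mult_distrib algebra_simps)
  show ?thesis unfolding perm
  proof
    assume inj: "inj f"
    have D: "den a b w \<noteq> 0" if "w ^ q * w = 1" for w
    proof
      assume "den a b w = 0"
      obtain x where "x \<noteq> 0" "circ x = w" using circ_surj[OF \<open>w ^ q * w = 1\<close>] .
      with den[of x] \<open>den a b w = 0\<close> have "f x = f 0" by (auto simp: f0)
      with inj \<open>x \<noteq> 0\<close> show False by (auto dest: injD)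
    qed
    moreover have "w1 = w2" if w: "w1 ^ q * w1 = 1" "w2 ^ q * w2 = 1"
      and eq: "num a b w1 * den a b w2 = num a b w2 * den a b w1" for w1 w2
    proof -
      obtain x1 x2 where x1: "x1 \<noteq> 0" "circ x1 = w1" and x2: "x2 \<noteq> 0" "circ x2 = w2"
        using circ_surj w by metis
      have wnz: "w1 \<noteq> 0" "w2 \<noteq> 0" using w by auto
      have fnz: "f x1 \<noteq> 0" "f x2 \<noteq> 0"
        using den[of x1] den[of x2] D w x1 x2 by auto
      have "(w1 * f x1 ^ q) * (w2 * f x2) = (x1 * x2) * (num a b w1 * den a b w2)"
        using num[of x1] den[of x2] x1 x2 by simp
      also have "\<dots> = (w2 * f x2 ^ q) * (w1 * f x1)"
        unfolding eq using num[of x2] den[of x1] x1 x2 by simp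
      finally have "f x1 ^ q * f x2 = f x2 ^ q * f x1" using wnz by (simp add: mult_ac)
      hence r: "(f x1 / f x2) ^ q = f x1 / f x2" "f x1 / f x2 \<noteq> 0"
        using fnz by (simp_all add: power_divide frac_eq_eq mult.commute)
      \<comment> \<open>The ratio of the values lies in F_q; scaling \<open>x2\<close> by it reaches
        the value at \<open>x1\<close>.\<close>
      have "f (f x1 / f x2 * x2) = f x1" using scale[OF r, of x2] fnz by simp
      hence "f x1 / f x2 * x2 = x1" using inj by (auto dest: injD)
      hence "circ x1 = circ (f x1 / f x2) * circ x2" by (metis circ_mult)
      thus "w1 = w2" using circ_fixed[OF r] x1 x2 by simp
    qed
    ultimately show "?D \<and> ?I" by blast
  next
    assume DI: "?D \<and> ?I"
    have nz: "f x \<noteq> 0" if "x \<noteq> 0" for x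
    proof
      assume "f x = 0"
      with den[of x] that have "den a b (circ x) = 0" by simp
      with DI circ_unit[OF that] show False by blast
    qed
    show "inj f"
    proof (rule injI)
      fix x1 x2 assume eq: "f x1 = f x2"
      show "x1 = x2"
      proof (cases "x1 = 0 \<or> x2 = 0")
        case True thus ?thesis using nz eq f0 by metis
      next
        case False
        hence x: "x1 \<noteq> 0" "x2 \<noteq> 0" by auto
        define w1 w2 where "w1 = circ x1" and "w2 = circ x2"
        have "(x1 * x2) * (num a b w1 * den a b w2) = (w1 * f x1 ^ q) * (w2 * f x2)"
          using num[of x1] den[of x2] x by (simp add: w1_def w2_def)
        also have "\<dots> = (w2 * f x2 ^ q) * (w1 * f x1)" unfolding eq by simp
        also have "\<dots> = (x1 * x2) * (num a b w2 * den a b w1)"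
          using num[of x2] den[of x1] x by (simp add: w1_def w2_def)
        finally have "num a b w1 * den a b w2 = num a b w2 * den a b w1" using x by simp
        moreover have un: "w1 ^ q * w1 = 1" "w2 ^ q * w2 = 1"
          using circ_unit x by (simp_all only: w1_def w2_def)
        ultimately have w: "w1 = w2" using DI by blast
        have "x1 * den a b w1 = x2 * den a b w1"
          using den[of x1] den[of x2] eq unfolding w[unfolded w1_def w2_def] w1_def by auto
        moreover have "den a b w1 \<noteq> 0" using DI un by blast
        ultimately show ?thesis by simp
      qed
    qed
  qed
qed

section \<open>Normal forms of the pencil spanned by numerator and denominator\<close>

lemma square_eq_1_iff2: "x * x = 1 \<longleftrightarrow> x = (1 :: 'a)"
proof
  assume "x * x = 1"
  hence "(x + 1) * (x + 1) = 0" by (simp add: algebra_simps)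
  thus "x = 1" by (simp add: add_eq_0_iff2)
qed simp

text \<open>This is a change of basis of determinant \<open>1 - c ^ 2\<close>, nonzero in
  characteristic two.\<close>

lemma pencil_cross:
  assumes "c \<noteq> (1 :: 'a)"
  shows "n1 * d2 = n2 * d1 \<longleftrightarrow> (n1 + c * d1) * (c * n2 + d2) = (n2 + c * d2) * (c * n1 + d1)"
proof -
  have "(n1 + c * d1) * (c * n2 + d2) + (n2 + c * d2) * (c * n1 + d1)
      = (1 + c * c) * (n1 * d2 + n2 * d1)"
    by (simp add: algebra_simps)
  moreover have "1 + c * c \<noteq> 0" using assms by (metis add_eq_0_iff2 square_eq_1_iff2)
  ultimately show ?thesis by (metis add_eq_0_iff2 mult_eq_0_iff)
qed

text \<open>The last hypothesis is the vanishing of the determinant of \<open>num + c * den\<close>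
  as a bilinear form in \<open>x ^ Q\<close> and \<open>x\<close>. The other member belongs to the
  parameter \<open>1 / c\<close>.\<close>

lemma pencil_factors:
  assumes "a \<noteq> 0" "c \<noteq> 0" "(b + c) * (1 + c * b) = c * a * a ^ q"
  shows "num a b x + c * den a b x = (c * a * x ^ Q + (b + c)) * (c * a * x + (1 + c * b)) / (c * a)"
    and "c * num a b x + den a b x = (a * x ^ Q + (1 + c * b)) * (a * x + (b + c)) / a"
proof -
  have "(c * a * x ^ Q + (b + c)) * (c * a * x + (1 + c * b))
    = c * a * (c * a * x ^ Q * x + x ^ Q * (1 + c * b) + (b + c) * x) + (b + c) * (1 + c * b)"
    by (simp add: algebra_simps)
  also have "\<dots> = c * a * (num a b x + c * den a b x)"
    unfolding assms(3) by (simp add: num_def den_def algebra_simps)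
  finally show "num a b x + c * den a b x =
    (c * a * x ^ Q + (b + c)) * (c * a * x + (1 + c * b)) / (c * a)"
    using assms(1,2) by simp
  have "(a * x ^ Q + (1 + c * b)) * (a * x + (b + c))
    = a * (a * x ^ Q * x + x ^ Q * (b + c) + (1 + c * b) * x) + (b + c) * (1 + c * b)"
    by (simp add: algebra_simps)
  also have "\<dots> = a * (c * num a b x + den a b x)"
    unfolding assms(3) by (simp add: num_def den_def algebra_simps)
  finally show "c * num a b x + den a b x = (a * x ^ Q + (1 + c * b)) * (a * x + (b + c)) / a"
    using assms(1) by simp
qed

text \<open>Inverting twice puts \<open>w\<close> in the field of four elements, where the
  \<open>q\<close>-power is the identity for even \<open>k\<close> and inverts nonzero elements for
  odd \<open>k\<close>.\<close>

lemma cube_root_trivial: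
  assumes w: "w ^ Q * w = (1 :: 'a)" and "even k \<Longrightarrow> w ^ q * w = 1" and "odd k \<Longrightarrow> w ^ q = w"
  shows "w = 1"
proof -
  have nz: "w \<noteq> 0" using w by auto
  have "w ^ Q = 1 / w" using w nz by (simp add: nonzero_eq_divide_eq)
  hence "(w ^ Q) ^ Q = w" by (simp add: power_divide)
  hence "w ^ 2 ^ (2 * l) = w" by (simp add: Q_def power_mult[symmetric] power_add[symmetric] mult_2)
  from frob_gcd[OF frob_2k this] k_pos have "w ^ 2 ^ gcd (2 * k) (2 * l) = w" by simp
  moreover have "gcd (2 * k) (2 * l) = 2"
  proof -
    have "coprime k l" using coprime_2k_l by simp
    thus ?thesis by (simp flip: gcd_mult_distrib_nat)
  qed
  ultimately have w4: "w ^ 2 ^ 2 = w" by simp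
  show ?thesis
  proof (cases "even k")
    case True
    then obtain j where "k = 2 * j" by (elim evenE)
    hence "w ^ q = w" using iterate_frob[OF w4, of j] by (simp add: q_def)
    thus ?thesis using assms(2)[OF True] by (simp add: square_eq_1_iff2)
  next
    case False
    then obtain j where "k = 2 * j + 1" by (elim oddE)
    hence "w ^ q = (w ^ 2 ^ (2 * j)) ^ 2" by (simp add: q_def power_mult[symmetric] mult.commute)
    also have "\<dots> = w * w" unfolding iterate_frob[OF w4] by (simp add: power2_eq_square)
    finally show ?thesis using assms(3)[OF False] nz by simp
  qed
qed

text \<open>A primitive cube root of unity is inverted by the \<open>Q\<close>-power because
  \<open>l\<close> is odd. It is the obstruction to injectivity in the other parity.\<close>

lemma exists_cube_root:
  "\<exists>w :: 'a. w \<noteq> 1 \<and> w ^ Q * w = 1 \<and> (if even k then w ^ q = w else w ^ q * w = 1)"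
proof -
  obtain w :: 'a where w: "w ^ 2 + w = 1" "w ^ q = w \<or> w ^ q = w + 1"
    using quadratic_root[of 1] by auto
  have w1: "w \<noteq> 1" using w by auto
  have w2: "w ^ 2 = w + 1"
    by (rule eq_transfer[OF w(1)]) (simp add: add_ac)
  have odd_pow: "w ^ 2 ^ n * w = 1" if "odd n" for n
    using w(1) by (simp add: frob_odd_of_cube_root[OF w2 that] power2_eq_square distrib_right)
  show ?thesis
  proof (intro exI conjI)
    show "w \<noteq> 1" by (rule w1)
    show "w ^ Q * w = 1" using odd_pow l_odd by (simp add: Q_def)
    show "if even k then w ^ q = w else w ^ q * w = 1"
      using odd_pow iterate_frob[OF frob_2_of_cube_root[OF w2]] by (auto simp: q_def elim!: evenE)
  qed
qed

text \<open>The two singular members of the pencil are \<open>num + c den\<close> and \<open>c num + den\<close>; in terms of \<open>z\<close>, the map \<open>num / den\<close> is conjugate to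
  \<open>x\<^bsup>Q-1\<^esup>\<close> if \<open>c = z / z\<^sup>Q\<close> and to \<open>x\<^bsup>Q+1\<^esup>\<close> if \<open>c = z\<^sup>Q z\<close>.\<close>
definition normal_form :: "'a \<Rightarrow> 'a \<Rightarrow> 'a \<Rightarrow> 'a \<Rightarrow> bool" where
  "normal_form a b c z \<longleftrightarrow> a \<noteq> 0 \<and> a ^ q = a \<and> c \<noteq> 0 \<and> c \<noteq> 1 \<and> z \<noteq> 0 \<and> z \<noteq> 1 \<and>
    a * z = b + c \<and> a * c = z * (1 + c * b)"

lemma normal_form_factors:
  assumes nf: "normal_form a b c z"
  shows "num a b x + c * den a b x = c * a * ((x ^ Q + z / c) * (x + 1 / z))"
    and "c * num a b x + den a b x = a * ((x ^ Q + c / z) * (x + z))"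
proof -
  have nz: "a \<noteq> 0" "c \<noteq> 0" "z \<noteq> 0" and aq: "a ^ q = a"
    and m: "b + c = a * z" and m': "1 + c * b = a * c / z"
    using nf by (auto simp: normal_form_def nonzero_eq_divide_eq mult.commute)
  have det: "(b + c) * (1 + c * b) = c * a * a ^ q" unfolding m m' aq using nz by simp
  show "num a b x + c * den a b x = c * a * ((x ^ Q + z / c) * (x + 1 / z))"
  proof -
    have "c * a * x ^ Q + a * z = c * a * (x ^ Q + z / c)" "c * a * x + a * c / z = c * a * (x + 1 / z)"
      using nz by (simp_all add: distrib_left)
    thus ?thesis unfolding pencil_factors(1)[OF nz(1,2) det] m m' using nz by simp
  qed
  show "c * num a b x + den a b x = a * ((x ^ Q + c / z) * (x + z))"
  proof -
    have "a * x ^ Q + a * c / z = a * (x ^ Q + c / z)" "a * x + a * z = a * (x + z)"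
      using nz by (simp_all add: distrib_left)
    thus ?thesis unfolding pencil_factors(2)[OF nz(1,2) det] m m' using nz by simp
  qed
qed

lemma normal_form_cross:
  assumes nf: "normal_form a b c z"
  shows "num a b x1 * den a b x2 = num a b x2 * den a b x1 \<longleftrightarrow>
    (x1 ^ Q + z / c) * (x1 + 1 / z) * ((x2 ^ Q + c / z) * (x2 + z)) =
    (x2 ^ Q + z / c) * (x2 + 1 / z) * ((x1 ^ Q + c / z) * (x1 + z))"
proof -
  have nz: "c \<noteq> 1" "c * a * a \<noteq> 0" using nf by (simp_all add: normal_form_def)
  have "num a b x1 * den a b x2 = num a b x2 * den a b x1 \<longleftrightarrow>
    c * a * a * ((x1 ^ Q + z / c) * (x1 + 1 / z) * ((x2 ^ Q + c / z) * (x2 + z))) =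
    c * a * a * ((x2 ^ Q + z / c) * (x2 + 1 / z) * ((x1 ^ Q + c / z) * (x1 + z)))"
    by (subst pencil_cross[OF nz(1)], unfold normal_form_factors[OF nf]) (simp only: mult_ac)
  thus ?thesis using nz(2) by simp
qed

text \<open>The Moebius map \<open>(x + 1 / z) / (x + z)\<close> has nonzero determinant
  \<open>z + 1 / z\<close>.\<close>

lemma moebius_cross:
  assumes "(x1 + 1 / z) * (x2 + z) = (x2 + 1 / z) * (x1 + z)" "z \<noteq> 0" "z \<noteq> (1 :: 'a)"
  shows "x1 = x2"
proof -
  have "(x1 + x2) * (z + 1 / z) = 0"
    using assms(1) by (rule eq_transfer)
      (simp add: algebra_simps add_divide_distrib assms(2))
  moreover have "z + 1 / z \<noteq> 0"
    using assms by (simp add: add_eq_0_iff2 nonzero_eq_divide_eq square_eq_1_iff2)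
  ultimately show ?thesis by (simp add: add_eq_0_iff2)
qed

text \<open>On the circle \<open>num\<close> is the conjugate of \<open>den\<close> times
  \<open>w ^ Q * w\<close>, so a zero of \<open>den\<close> annihilates the whole pencil.\<close>

lemma normal_form_den_zero:
  assumes nf: "normal_form a b c z" and b: "b ^ q = b" and w: "w ^ q * w = 1"
    and den: "den a b w = 0"
  shows "(w ^ Q + z / c) * (w + 1 / z) = 0" "(w ^ Q + c / z) * (w + z) = 0"
proof -
  have wq: "w \<noteq> 0" "w ^ q = 1 / w" using unit_circle_inverse[OF w] by auto
  have "den a b w ^ q * (w ^ Q * w) = num a b w"
    using wq by (simp add: den_def num_def add_power_q power_mult_distrib b
      power_divide power_q_power_Q_commute[symmetric] algebra_simps)
  hence "num a b w = 0" using den by simp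
  with normal_form_factors[OF nf, of w] den nf
  show "(w ^ Q + z / c) * (w + 1 / z) = 0" "(w ^ Q + c / z) * (w + z) = 0"
    by (simp_all add: normal_form_def)
qed

text \<open>In the coordinate \<open>(x + 1 / z) / (x + z)\<close> the map is the power
  \<open>1 - Q\<close> or \<open>1 + Q\<close>; \<open>power_Q_cross\<close> handles the first and
  \<open>cube_root_trivial\<close> the second.\<close>

lemma normal_form_sufficient:
  assumes nf: "normal_form a b c z" and b: "b ^ q = b"
    and c: "z ^ q = z \<and> c = z / z ^ Q \<or> (if even k then z ^ q = z else z ^ q * z = 1) \<and> c = z ^ Q * z"
  shows "\<And>w. w ^ q * w = 1 \<Longrightarrow> den a b w \<noteq> 0"
    and "\<And>x1 x2. x1 ^ q * x1 = 1 \<Longrightarrow> x2 ^ q * x2 = 1 \<Longrightarrow>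
      num a b x1 * den a b x2 = num a b x2 * den a b x1 \<Longrightarrow> x1 = x2"
proof -
  have z: "z \<noteq> 0" "z \<noteq> 1" using nf by (simp_all add: normal_form_def)
  \<comment> \<open>F_q meets the circle only in 1, so the linear factors do not vanish on the
    circle.\<close>
  have K: "w \<noteq> z \<and> w \<noteq> 1 / z" if "z ^ q = z" "w ^ q * w = 1" for w
  proof -
    have "w ^ q = w \<Longrightarrow> w = 1" using that(2) by (simp add: square_eq_1_iff2)
    thus ?thesis using that z by (auto simp: power_divide)
  qed
  show "den a b w \<noteq> 0" if w: "w ^ q * w = 1" for w
  proof
    assume "den a b w = 0"
    note zero = normal_form_den_zero[OF nf b w this]
    show False using c
    proof
      assume c: "z ^ q = z \<and> c = z / z ^ Q"
      hence "(w + z) ^ Q * (w + 1 / z) = 0" using zero(1) z by (simp add: add_power_Q)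
      with K[OF _ w] c show False by (auto simp: add_eq_0_iff2)
    next
      assume c: "(if even k then z ^ q = z else z ^ q * z = 1) \<and> c = z ^ Q * z"
      hence "(w + 1 / z) ^ Q * (w + 1 / z) = 0" "(w + z) ^ Q * (w + z) = 0"
        using zero z by (simp_all add: add_power_Q power_divide)
      hence "w = 1 / z" "w = z" by (auto simp: add_eq_0_iff2)
      thus False using z by (simp add: nonzero_eq_divide_eq square_eq_1_iff2)
    qed
  qed
  show "x1 = x2" if x1: "x1 ^ q * x1 = 1" and x2: "x2 ^ q * x2 = 1"
    and eq: "num a b x1 * den a b x2 = num a b x2 * den a b x1" for x1 x2
  proof -
    \<comment> \<open>\<open>P / R\<close> is the quotient of the coordinates of \<open>x1\<close>
      and \<open>x2\<close>.\<close>
    define P R where "P = (x1 + 1 / z) * (x2 + z)" and "R = (x2 + 1 / z) * (x1 + z)"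
    note eq' = eq[unfolded normal_form_cross[OF nf]]
    have "P = R" using c
    proof
      assume c: "z ^ q = z \<and> c = z / z ^ Q"
      hence zc: "z / c = z ^ Q" "c / z = (1 / z) ^ Q" using z by (simp_all add: power_divide)
      have "R ^ Q * P = P ^ Q * R"
        using eq'[unfolded zc, folded add_power_Q]
        by (simp add: P_def R_def power_mult_distrib mult_ac)
      moreover have "P \<noteq> 0" "R \<noteq> 0"
        using K[OF _ x1] K[OF _ x2] c by (auto simp: P_def R_def add_eq_0_iff2)
      ultimately show "P = R" using power_Q_cross by metis
    next
      assume c: "(if even k then z ^ q = z else z ^ q * z = 1) \<and> c = z ^ Q * z"
      hence zc: "z / c = (1 / z) ^ Q" "c / z = z ^ Q" using z by (simp_all add: power_divide)
      have PR: "P ^ Q * P = R ^ Q * R"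
        using eq'[unfolded zc, folded add_power_Q]
        by (simp add: P_def R_def power_mult_distrib mult_ac)
      show "P = R"
      proof (cases "R = 0")
        case True thus ?thesis using PR by auto
      next
        case False
        with PR have "P \<noteq> 0" by auto
        have x: "x1 \<noteq> 0" "x1 ^ q = 1 / x1" "x2 \<noteq> 0" "x2 ^ q = 1 / x2"
          using unit_circle_inverse x1 x2 by auto
        have "P / R = 1"
        proof (rule cube_root_trivial)
          show "(P / R) ^ Q * (P / R) = 1" using PR False by (simp add: power_divide)
        next
          \<comment> \<open>For \<open>z\<close> in F_q conjugation inverts \<open>P / R\<close>; in
            the odd case below, with \<open>z\<close> on the circle, it fixes
            \<open>P / R\<close>.\<close>
          assume "even k"
          hence "z ^ q = z" using c by simp
          hence conj: "(x + 1 / z) ^ q * x = (x + z) / z" "(x + z) ^ q * x = z * (x + 1 / z)"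
            if "x ^ q = 1 / x" "x \<noteq> 0" for x
            using that z by (simp_all add: add_power_q power_divide distrib_left distrib_right
              add_divide_distrib add.commute)
          have "P ^ q * (x1 * x2) = ((x1 + 1 / z) ^ q * x1) * ((x2 + z) ^ q * x2)"
            by (simp only: P_def power_mult_distrib mult_ac)
          also have "\<dots> = R" unfolding conj[OF x(2,1)] conj[OF x(4,3)] using z by (simp add: R_def)
          finally have Pq: "P ^ q * (x1 * x2) = R" .
          have "R ^ q * (x1 * x2) = ((x2 + 1 / z) ^ q * x2) * ((x1 + z) ^ q * x1)"
            by (simp only: R_def power_mult_distrib mult_ac)
          also have "\<dots> = P" unfolding conj[OF x(2,1)] conj[OF x(4,3)] using z by (simp add: P_def)
          finally have Rq: "R ^ q * (x1 * x2) = P" .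
          have "(P ^ q * P) * (x1 * x2) = (P ^ q * (x1 * x2)) * P" by (simp only: mult_ac)
          also have "\<dots> = (R ^ q * (x1 * x2)) * R" unfolding Pq Rq by (rule mult.commute)
          also have "\<dots> = (R ^ q * R) * (x1 * x2)" by (simp only: mult_ac)
          finally have "P ^ q * P = R ^ q * R" using x by simp
          thus "(P / R) ^ q * (P / R) = 1" using False x by (simp add: power_divide)
        next
          assume "odd k"
          hence "z ^ q = 1 / z" using c unit_circle_inverse(2)[of z] by simp
          hence conj: "(x + 1 / z) ^ q * x = z * (x + 1 / z)" "(x + z) ^ q * x = (x + z) / z"
            if "x ^ q = 1 / x" "x \<noteq> 0" for x
            using that z by (simp_all add: add_power_q power_divide distrib_left distrib_right
              add_divide_distrib add.commute)
          have "P ^ q * (x1 * x2) = ((x1 + 1 / z) ^ q * x1) * ((x2 + z) ^ q * x2)"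
            by (simp only: P_def power_mult_distrib mult_ac)
          also have "\<dots> = P" unfolding conj[OF x(2,1)] conj[OF x(4,3)] using z by (simp add: P_def)
          finally have Pq: "P ^ q * (x1 * x2) = P" .
          have "R ^ q * (x1 * x2) = ((x2 + 1 / z) ^ q * x2) * ((x1 + z) ^ q * x1)"
            by (simp only: R_def power_mult_distrib mult_ac)
          also have "\<dots> = R" unfolding conj[OF x(2,1)] conj[OF x(4,3)] using z by (simp add: R_def)
          finally have Rq: "R ^ q * (x1 * x2) = R" .
          have "(P ^ q * R) * (x1 * x2) = (P ^ q * (x1 * x2)) * R" by (simp only: mult_ac)
          also have "\<dots> = (R ^ q * (x1 * x2)) * P" unfolding Pq Rq by (rule mult.commute)
          also have "\<dots> = (R ^ q * P) * (x1 * x2)" by (simp only: mult_ac)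
          finally have "P ^ q * R = R ^ q * P" using x by simp
          thus "(P / R) ^ q = P / R" using False x by (simp add: power_divide frac_eq_eq)
        qed
        thus ?thesis using False by simp
      qed
    qed
    thus "x1 = x2" unfolding P_def R_def using z by (rule moebius_cross)
  qed
qed

section \<open>Injectivity forces a normal form\<close>

lemma exists_Q_root: obtains t where "t ^ Q = (x :: 'a)"
proof -
  have "inj (\<lambda>t :: 'a. t ^ Q)" by (rule injI) simp
  hence "surj (\<lambda>t :: 'a. t ^ Q)" by (simp add: finite_UNIV_inj_surj)
  thus thesis using that by (metis surjD)
qed

lemma unit_circle_Q_root:
  assumes "t ^ Q = x" "x ^ q * x = 1" shows "t ^ q * t = (1 :: 'a)"
proof -
  have "(t ^ q * t) ^ Q = 1"
    using assms by (simp add: power_mult_distrib power_q_power_Q_commute)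
  thus ?thesis by simp
qed

text \<open>The power \<open>Q + 1\<close> does not see a cube root of unity \<open>w\<close>, so
  two points whose coordinates differ by the factor \<open>w\<close> collide.\<close>

lemma normal_form_wrong_parity:
  assumes nf: "normal_form a b c z" and c: "c = z ^ Q * z"
    and z: "even k \<Longrightarrow> z ^ q * z = 1" "odd k \<Longrightarrow> z ^ q = z"
  obtains x1 x2 where "x1 ^ q * x1 = 1" "x2 ^ q * x2 = 1" "x1 \<noteq> x2"
    "num a b x1 * den a b x2 = num a b x2 * den a b x1"
proof -
  have znz: "z \<noteq> 0" "z \<noteq> 1" using nf by (simp_all add: normal_form_def)
  obtain w :: 'a where w: "w \<noteq> 1" "w ^ Q * w = 1" "if even k then w ^ q = w else w ^ q * w = 1"
    using exists_cube_root by blast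
  have wnz: "w \<noteq> 0" using w(2) by auto
  have zw: "z + w \<noteq> 0"
  proof
    assume "z + w = 0"
    hence "z = w" by (simp only: add_eq_0_iff2)
    hence "z * z = 1" using z w by (cases "even k") auto
    with znz show False by (simp add: square_eq_1_iff2)
  qed
  \<comment> \<open>The point 1 has coordinate \<open>1 / z\<close>, and \<open>x\<close> is the
    point with coordinate \<open>w / z\<close>. One of \<open>z\<close>, \<open>w\<close> lies in
    F_q and the other on the circle, which puts \<open>x\<close> on the circle.\<close>
  define x where "x = (w * z + 1) / (z + w)"
  have fact: "w * z + 1 + (z + w) = (w + 1) * (z + 1)" by (simp add: algebra_simps)
  have x1: "x \<noteq> 1"
  proof
    assume "x = 1"
    hence "w * z + 1 = z + w" using zw by (simp add: x_def)
    with fact have "(w + 1) * (z + 1) = 0" by simp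
    with w(1) znz show False by (simp add: add_eq_0_iff2)
  qed
  have conj: "(w * z + 1) ^ q * (w * z + 1) = (z + w) ^ q * (z + w)"
  proof (cases "even k")
    case True
    hence "z ^ q = 1 / z" "w ^ q = w" using z unit_circle_inverse(2) w by auto
    hence "(w * z + 1) ^ q = (z + w) / z" "(z + w) ^ q = (w * z + 1) / z" using znz
      by (simp_all add: add_power_q power_mult_distrib add_divide_distrib add.commute)
    thus ?thesis by simp
  next
    case False
    hence "z ^ q = z" "w ^ q = 1 / w" using z unit_circle_inverse(2) w by auto
    hence "(w * z + 1) ^ q = (z + w) / w" "(z + w) ^ q = (w * z + 1) / w" using wnz
      by (simp_all add: add_power_q power_mult_distrib add_divide_distrib add.commute)
    thus ?thesis by simp
  qed
  have xU: "x ^ q * x = 1"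
    using conj zw by (simp add: x_def power_divide)
  have zc: "z / c = (1 / z) ^ Q" "c / z = z ^ Q" using znz c by (simp_all add: power_divide)
  define P R where "P = (1 + 1 / z) * (x + z)" and "R = (x + 1 / z) * (1 + z)"
  have "(x + 1 / z) * z = x * z + 1" using znz by (simp add: distrib_right)
  also have "\<dots> = ((w * z + 1) * z + (z + w)) / (z + w)"
    using zw by (simp add: x_def divide_add_eq_iff)
  also have "(w * z + 1) * z + (z + w) = w * (w * z + 1 + z * (z + w))"
    by (simp add: algebra_simps)
  also have "w * (w * z + 1 + z * (z + w)) / (z + w) = w * (x + z)"
    using zw by (simp add: x_def divide_add_eq_iff)
  finally have "x + 1 / z = w * (x + z) / z" using znz by (simp add: nonzero_eq_divide_eq)
  moreover have "1 + 1 / z = (1 + z) / z" using znz by (simp add: add_divide_distrib add.commute)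
  ultimately have R: "R = w * P" by (simp add: P_def R_def)
  have "P ^ Q * P = R ^ Q * R"
  proof -
    have "R ^ Q * R = (w ^ Q * w) * (P ^ Q * P)" by (simp add: R power_mult_distrib mult_ac)
    thus ?thesis by (simp add: w(2))
  qed
  hence "num a b 1 * den a b x = num a b x * den a b 1"
    unfolding normal_form_cross[OF nf] unfolding zc add_power_Q[symmetric]
    by (simp only: P_def R_def power_mult_distrib mult_ac)
  thus thesis using that[of 1 x] xU x1 by simp
qed

text \<open>Otherwise \<open>num + den\<close> factors and vanishes at circle points
  \<open>r\<close> and \<open>t\<close> with \<open>t ^ Q = r\<close>. Injectivity gives
  \<open>r = t\<close>, hence \<open>r = 1\<close>, that is \<open>a = b + 1\<close>.\<close>

lemma injective_double_point:
  assumes b: "b ^ q = b" and a: "a \<noteq> 0" and ab: "a + b \<noteq> 1"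
    and I: "\<And>x1 x2. x1 ^ q * x1 = 1 \<Longrightarrow> x2 ^ q * x2 = 1 \<Longrightarrow>
      num a b x1 * den a b x2 = num a b x2 * den a b x1 \<Longrightarrow> x1 = x2"
  shows "1 + b ^ 2 + a ^ q * a \<noteq> 0"
proof
  assume S: "1 + b ^ 2 + a ^ q * a = 0"
  have det: "(b + 1) * (1 + 1 * b) = 1 * a * a ^ q"
    using S by (rule eq_transfer) (simp add: power2_eq_square algebra_simps)
  define r where "r = (b + 1) / a"
  obtain t where t: "t ^ Q = r" by (rule exists_Q_root)
  have rU: "r ^ q * r = 1"
    using det a by (simp add: r_def power_divide add_power_q b add.commute mult.commute)
  have tU: "t ^ q * t = 1" using t rU by (rule unit_circle_Q_root)
  have "num a b x + 1 * den a b x = 0" if "x = r \<or> x = t" for x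
    using that a t unfolding pencil_factors(1)[OF a one_neq_zero det]
    by (auto simp: r_def add.commute)
  hence "num a b r = den a b r" "num a b t = den a b t" by (simp_all add: add_eq_0_iff2)
  hence "r = t" using I[OF rU tU] by simp
  hence "r = 0 \<or> r = 1" using fixed_Q t by simp
  hence "r = 1" using rU by auto
  hence "b + 1 = a" using a by (simp add: r_def)
  with ab show False by (metis add.commute add_self_left)
qed

text \<open>Each singular member has a circle zero from each linear factor, and injectivity makes
  the two equal. The resulting equations force \<open>r * r'\<close> to be fixed by the
  \<open>Q\<close>-power, hence 1, and \<open>z = r'\<close> works.\<close>

lemma injective_singular_on_circle:
  assumes b: "b ^ q = b" and a: "a \<noteq> 0" and c: "c \<noteq> 1" "c ^ q * c = 1"
    and det: "(b + c) * (1 + c * b) = c * a * a ^ q"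
    and I: "\<And>x1 x2. x1 ^ q * x1 = 1 \<Longrightarrow> x2 ^ q * x2 = 1 \<Longrightarrow>
      num a b x1 * den a b x2 = num a b x2 * den a b x1 \<Longrightarrow> x1 = x2"
  shows "\<exists>z. normal_form a b c z \<and> z ^ q * z = 1 \<and> c = z ^ Q * z"
proof -
  have cc: "c \<noteq> 0" "c ^ q = 1 / c" using unit_circle_inverse[OF c(2)] by auto
  define m m' where "m = b + c" and "m' = 1 + c * b"
  have mm: "m * m' = c * a * a ^ q" using det by (simp only: m_def m'_def)
  have m: "m \<noteq> 0" using mm a cc by auto
  have m': "m' = c * a * a ^ q / m" using mm m by (simp add: nonzero_eq_divide_eq mult.commute)
  have "m ^ q = m' / c"
    using cc by (simp add: m_def m'_def add_power_q b add_divide_distrib add.commute)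
  hence mq: "m ^ q = a * a ^ q / m" using cc by (simp add: m')
  define r r' where "r = a ^ q / m" and "r' = m / a"
  have nz: "r \<noteq> 0" "r' \<noteq> 0" using m a by (simp_all add: r_def r'_def)
  have rU: "r ^ q * r = 1" and r'U: "r' ^ q * r' = 1"
    and r'cU: "(r' / c) ^ q * (r' / c) = 1" and rcU: "(c * r) ^ q * (c * r) = 1"
    using cc a m by (simp_all add: r_def r'_def power_divide power_mult_distrib mq)
  note factors = pencil_factors[OF a cc(1) det, folded m_def m'_def]
  obtain t where t: "t ^ Q = r' / c" by (rule exists_Q_root)
  obtain t' where t': "t' ^ Q = c * r" by (rule exists_Q_root)
  have tU: "t ^ q * t = 1" using t r'cU by (rule unit_circle_Q_root)
  have t'U: "t' ^ q * t' = 1" using t' rcU by (rule unit_circle_Q_root)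
  have zero: "num a b x + c * den a b x = 0" if "x = r \<or> x = t" for x
    using that a cc m t unfolding factors(1) by (auto simp: r_def r'_def m')
  have "num a b r = c * den a b r" "num a b t = c * den a b t"
    using zero[of r] zero[of t] by (simp_all add: add_eq_0_iff2)
  hence "r = t" using I[OF rU tU] by simp
  hence rQ: "r ^ Q = r' / c" using t by simp
  have zero': "c * num a b x + den a b x = 0" if "x = r' \<or> x = t'" for x
    using that a cc m t' unfolding factors(2) by (auto simp: r_def r'_def m' mult_ac)
  have z1: "c * num a b r' = den a b r'" "c * num a b t' = den a b t'"
    using zero'[of r'] zero'[of t'] by (simp_all add: add_eq_0_iff2)
  hence "r' = t'" using I[OF r'U t'U] by (simp flip: z1)
  hence r'Q: "r' ^ Q = c * r" using t' by simp
  have "(r * r') ^ Q = r * r'" using rQ r'Q cc by (simp add: power_mult_distrib)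
  hence "r * r' = 1" using fixed_Q[of "r * r'"] nz by auto
  hence r: "r = 1 / r'" using nz by (simp add: nonzero_eq_divide_eq)
  have aq: "a ^ q = a" using \<open>r * r' = 1\<close> a m by (simp add: r_def r'_def)
  have cz: "c = r' ^ Q * r'" using r'Q r nz by simp
  have "r' \<noteq> 1" using cz c by auto
  moreover have "a * c = r' * (1 + c * b)"
    using a m unfolding m'_def[symmetric] by (simp add: r'_def m' aq)
  ultimately have "normal_form a b c r'"
    using a aq cc c nz by (simp add: normal_form_def r'_def m_def)
  with cz r'U show ?thesis by blast
qed

text \<open>A Moebius substitution reaches the shape refuted by
  \<open>circle_map_not_injective\<close> unless \<open>E\<close> or \<open>G\<close> vanishes.
  \<open>E = 0\<close> yields \<open>c = z / z ^ Q\<close> with \<open>z = t\<close>;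
  \<open>G = 0\<close> yields \<open>c = z ^ Q * z\<close> with \<open>z = 1 / t\<close>.\<close>

lemma injective_singular_off_circle:
  assumes b: "b ^ q = b" and b0: "b \<noteq> 0" and a: "a \<noteq> 0" and c: "c \<noteq> 0" "c \<noteq> 1" "c ^ q = c"
    and det: "(b + c) * (1 + c * b) = c * a * a ^ q"
    and I: "\<And>x1 x2. x1 ^ q * x1 = 1 \<Longrightarrow> x2 ^ q * x2 = 1 \<Longrightarrow>
      num a b x1 * den a b x2 = num a b x2 * den a b x1 \<Longrightarrow> x1 = x2"
  shows "\<exists>z. normal_form a b c z \<and> z ^ q = z \<and> (c = z / z ^ Q \<or> c = z ^ Q * z)"
proof -
  define m m' where "m = b + c" and "m' = 1 + c * b"
  have mm: "m * m' = c * a * a ^ q" using det by (simp only: m_def m'_def)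
  have nz: "m \<noteq> 0" "m' \<noteq> 0" using mm a c by auto
  have mq: "m ^ q = m" "m' ^ q = m'"
    by (simp_all add: m_def m'_def add_power_q power_mult_distrib b c)
  have m'_eq: "m' = c * a * a ^ q / m" using mm nz by (simp add: nonzero_eq_divide_eq mult.commute)
  have c2: "c * c \<noteq> 1" using c by (simp add: square_eq_1_iff2)
  obtain t where t: "t ^ Q = m / (c * a)" by (rule exists_Q_root)
  have tnz: "t \<noteq> 0" using t nz a c by auto
  have tq: "(t ^ q) ^ Q = m / (c * a ^ q)"
    using t by (simp add: power_q_power_Q_commute power_divide power_mult_distrib mq c)
  define N where "N = t ^ q * t"
  \<comment> \<open>If \<open>t\<close> were on the circle, then \<open>m = c * m'\<close>, that is
    \<open>b * (1 + c * c) = 0\<close>.\<close>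
  have N1: "1 + N \<noteq> 0"
  proof
    assume "1 + N = 0"
    hence "N = 1" by (simp add: add_eq_0_iff2)
    hence "(t ^ q) ^ Q * t ^ Q = 1" by (simp flip: power_mult_distrib N_def)
    hence "m * m = c * (c * a * a ^ q)" unfolding t tq using a c by (simp add: field_simps)
    hence "m * m = m * (c * m')" unfolding mm[symmetric] by (simp only: mult_ac)
    hence "m = c * m'" using nz by simp
    hence "m + c * m' = 0" by simp
    hence "b * (1 + c * c) = 0" by (simp add: m_def m'_def algebra_simps)
    with b0 c2 show False by (simp add: add_eq_0_iff2)
  qed
  \<comment> \<open>These are the coefficients of the numerator of \<open>c * a * X y + m'\<close>
    for the substitution \<open>X\<close> below.\<close>
  define E G where "E = c * a + m' * t ^ q" and "G = c * a * t + m'"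
  have Eq: "E ^ q = c * a ^ q + m' * t" and Gq: "G ^ q = c * a ^ q * t ^ q + m'"
    by (simp_all add: E_def G_def add_power_q power_mult_distrib mq c)
  have "E = 0 \<or> G = 0"
  proof (rule ccontr)
    assume "\<not> (E = 0 \<or> G = 0)"
    hence EG: "E \<noteq> 0" "G \<noteq> 0" by auto
    have "E ^ q * E + G ^ q * G = (c * (c * a * a ^ q) + m' * m') * (1 + N)"
      unfolding Eq Gq by (simp add: E_def G_def N_def algebra_simps)
    also have "\<dots> = m' * (c * m + m') * (1 + N)"
      unfolding mm[symmetric] by (simp add: algebra_simps)
    also have "c * m + m' = 1 + c * c" by (simp add: m_def m'_def algebra_simps)
    finally have "E ^ q * E + G ^ q * G \<noteq> 0" using nz N1 c2 by (simp add: add_eq_0_iff2)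
    hence "E ^ q * E \<noteq> G ^ q * G" by (simp only: add_eq_0_iff2) simp
    then obtain y1 y2 where y: "y1 ^ q * y1 = 1" "y2 ^ q * y2 = 1" "y1 \<noteq> y2"
      and eq: "y1 ^ Q * (E * y1 + G) * (G ^ q * y2 + E ^ q) = y2 ^ Q * (E * y2 + G) * (G ^ q * y1 + E ^ q)"
      using circle_map_not_injective[OF EG] by blast
    \<comment> \<open>\<open>X\<close> preserves the circle and sends 0 and infinity to
      \<open>t\<close> and \<open>1 / t ^ q\<close>, the zeros of the \<open>x ^ Q\<close>-factors
      of the two singular members.\<close>
    define d where "d y = t ^ q * y + 1" for y
    define X where "X y = (y + t) / d y" for y
    have d: "d y \<noteq> 0" if "y ^ q * y = 1" for y
    proof
      assume "d y = 0"
      hence ty: "t ^ q * y = 1" by (simp add: d_def add_eq_0_iff2)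
      have "N * (y ^ q * y) = (t ^ q * y) ^ q * (t ^ q * y)"
        by (simp add: N_def power_mult_distrib mult_ac)
      hence "N = 1" by (simp add: ty that)
      with N1 show False by simp
    qed
    have XU: "X y ^ q * X y = 1" if yU: "y ^ q * y = 1" for y
    proof -
      have "(y + t) ^ q * (y + t) = y ^ q * y + y ^ q * t + t ^ q * y + N"
        by (simp add: add_power_q N_def algebra_simps)
      also have "\<dots> = N * (y ^ q * y) + y ^ q * t + t ^ q * y + 1" unfolding yU by (simp add: add_ac)
      also have "\<dots> = d y ^ q * d y"
        by (simp add: d_def add_power_q power_mult_distrib N_def algebra_simps)
      finally show ?thesis using d[OF yU] by (simp add: X_def power_divide)
    qed
    have Xt: "X y + t = y * (1 + N) / d y" "t ^ q * X y + 1 = (1 + N) / d y" if "d y \<noteq> 0" for y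
    proof -
      have "X y + t = (y + t + t * d y) / d y" using that by (simp add: X_def add_divide_distrib)
      thus "X y + t = y * (1 + N) / d y" by (simp add: d_def N_def algebra_simps)
      have "t ^ q * X y + 1 = (t ^ q * (y + t) + d y) / d y"
        using that by (simp add: X_def divide_add_eq_iff)
      thus "t ^ q * X y + 1 = (1 + N) / d y" by (simp add: d_def N_def algebra_simps)
    qed
    have X_ne: "X y1 \<noteq> X y2"
    proof
      assume "X y1 = X y2"
      hence "(y1 + t) * d y2 = (y2 + t) * d y1" using d y by (simp add: X_def frac_eq_eq)
      hence "(y1 + y2) * (1 + N) = 0"
        by (rule eq_transfer) (simp add: d_def N_def algebra_simps)
      with N1 y(3) show False by (simp add: add_eq_0_iff2)
    qed
    note factors = pencil_factors[OF a c(1) det, folded m_def m'_def]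
    define u where "u y = (1 + N) ^ Q / (d y ^ Q * d y)" for y
    have F1: "num a b (X y) + c * den a b (X y) = u y * (y ^ Q * (E * y + G))" if "d y \<noteq> 0" for y
    proof -
      have "c * a * X y ^ Q + m = c * a * (X y + t) ^ Q"
        using a c by (simp add: add_power_Q t distrib_left)
      moreover have "c * a * X y + m' = (c * a * (y + t) + m' * d y) / d y"
        using that by (simp add: X_def divide_add_eq_iff)
      hence "c * a * X y + m' = (E * y + G) / d y" by (simp add: d_def E_def G_def algebra_simps)
      ultimately show ?thesis
        unfolding factors(1) Xt(1)[OF that] using a c
        by (simp add: u_def power_mult_distrib power_divide)
    qed
    have F2: "c * num a b (X y) + den a b (X y) = u y * (G ^ q * y + E ^ q)" if "d y \<noteq> 0" for y
    proof -
      have "m' * (t ^ q) ^ Q = a" unfolding tq m'_eq using nz a c by simp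
      hence "a * X y ^ Q + m' = m' * (t ^ q * X y + 1) ^ Q"
        by (simp add: add_power_Q power_mult_distrib distrib_left flip: mult.assoc)
      moreover have "m * (G ^ q * y + E ^ q) = c * a ^ q * (a * (y + t) + m * d y)"
      proof -
        have "m * (G ^ q * y + E ^ q) = m * c * a ^ q * (t ^ q * y + 1) + (m * m') * (y + t)"
          unfolding Eq Gq by (simp add: algebra_simps)
        thus ?thesis unfolding mm by (simp add: d_def algebra_simps)
      qed
      hence "a * (y + t) + m * d y = m * (G ^ q * y + E ^ q) / (c * a ^ q)" using a c by simp
      hence "a * X y + m = m * (G ^ q * y + E ^ q) / (c * a ^ q) / d y"
        using that by (simp add: X_def add_divide_distrib[symmetric] divide_add_eq_iff)
      ultimately show ?thesis
        unfolding factors(2) Xt(2)[OF that] unfolding m'_eq using a c nz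
        by (simp add: u_def power_divide)
    qed
    have dd: "d y1 \<noteq> 0" "d y2 \<noteq> 0" using d y by auto
    have "u y1 * u y2 * (y1 ^ Q * (E * y1 + G) * (G ^ q * y2 + E ^ q)) =
      u y1 * u y2 * (y2 ^ Q * (E * y2 + G) * (G ^ q * y1 + E ^ q))" unfolding eq ..
    hence "num a b (X y1) * den a b (X y2) = num a b (X y2) * den a b (X y1)"
      by (subst pencil_cross[OF c(2)], unfold F1[OF dd(1)] F1[OF dd(2)] F2[OF dd(1)] F2[OF dd(2)])
         (simp only: mult_ac)
    with I[OF XU[OF y(1)] XU[OF y(2)]] X_ne show False by simp
  qed
  thus ?thesis
  proof
    assume "E = 0"
    hence E: "c * a = m' * t ^ q" by (simp add: E_def add_eq_0_iff2)
    hence mt: "m = a ^ q * t ^ q" using nz a c unfolding m'_eq by (simp add: field_simps)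
    hence "m ^ q = (a ^ q * t ^ q) ^ q" by simp
    hence mt': "m = a * t" by (simp add: mq power_mult_distrib)
    have tQ: "t ^ Q = t / c" "(t ^ q) ^ Q = t ^ q / c"
      unfolding t tq using a c by (simp add: mt', simp add: mt)
    have tt: "t ^ q = t" by (rule power_Q_cross) (use tQ tnz in simp_all)
    have aq: "a ^ q = a" using mt mt' tt tnz by simp
    have ct: "c = t / t ^ Q" using tQ tnz by simp
    have "t \<noteq> 1" using ct c by auto
    hence "normal_form a b c t"
      using a aq c tnz mt' E tt by (simp add: normal_form_def m_def m'_def mult.commute)
    with tt ct show ?thesis by blast
  next
    assume "G = 0"
    hence G: "c * a * t = m'" by (simp add: G_def add_eq_0_iff2)
    hence at: "a ^ q = m * t" using nz a c unfolding m'_eq by (simp add: field_simps)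
    hence "(a ^ q) ^ q = (m * t) ^ q" by simp
    hence at': "a = m * t ^ q" by (simp add: mq power_mult_distrib)
    have "t ^ q = t"
    proof (rule power_Q_cross)
      have "t ^ Q * t ^ q = 1 / c" unfolding t using at' nz tnz c a by (simp add: field_simps)
      moreover have "(t ^ q) ^ Q * t = 1 / c" unfolding tq using at nz tnz c a by (simp add: field_simps)
      ultimately show "(t ^ q) ^ Q * t = t ^ Q * t ^ q" by simp
    qed (use tnz in simp_all)
    note tt = this
    have aq: "a ^ q = a" using at at' tt by simp
    define z where "z = 1 / t"
    have zQ: "z ^ Q = c * t" unfolding z_def power_one_over t using at aq nz by simp
    have cz: "c = z ^ Q * z" unfolding zQ using tnz by (simp add: z_def)
    have "z \<noteq> 1" using cz c by auto
    moreover have "z ^ q = z" using tt by (simp add: z_def power_divide)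
    moreover have "a * z = b + c" using at aq tnz by (simp add: z_def m_def)
    moreover have "a * c = z * (1 + c * b)"
      unfolding m'_def[symmetric] G[symmetric] using tnz by (simp add: z_def)
    moreover have "z \<noteq> 0" using tnz by (simp add: z_def)
    ultimately have "normal_form a b c z" using a aq c by (simp add: normal_form_def)
    with \<open>z ^ q = z\<close> cz show ?thesis by blast
  qed
qed

text \<open>Both equations are symmetric under inverting \<open>z\<close> and \<open>c\<close>
  together; \<open>z + 1 / z\<close> becomes the parameter \<open>lam\<close>.\<close>

lemma normal_form_equations:
  assumes "normal_form a b c z"
  shows "a * (z + 1 / z) = c + 1 / c" "b * (z + 1 / z) = c / z + z / c"
proof -
  have nz: "c \<noteq> 0" "z \<noteq> 0" and az: "a * z = b + c" and ac: "a * c = z * (1 + c * b)"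
    using assms by (simp_all add: normal_form_def)
  have az': "a / z = b + 1 / c"
    using ac nz by (simp add: field_simps)
  show "a * (z + 1 / z) = c + 1 / c"
    using az az' by (simp add: distrib_left add_ac)
  have "(b + c) / z = a" using az nz by (simp flip: az)
  moreover have "(b + 1 / c) * z = a" using nz by (simp flip: az')
  ultimately have "(b + c) / z = (b + 1 / c) * z" by simp
  thus "b * (z + 1 / z) = c / z + z / c"
    by (rule eq_transfer) (simp add: algebra_simps add_divide_distrib)
qed

text \<open>Conjugation fixes \<open>x + 1 / x\<close> for \<open>x\<close> in F_q or on the circle,
  so \<open>a ^ q = a\<close> follows; the linear conditions come back after cancelling
  \<open>L\<close>.\<close>

lemma normal_form_intro:
  assumes z: "z \<noteq> 0" "z \<noteq> 1" "z ^ q = z \<or> z ^ q * z = 1" and a: "a \<noteq> 0"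
    and c: "c \<noteq> 0" "c ^ q = c \<or> c ^ q * c = 1"
    and eqa: "a * (z + 1 / z) = c + 1 / c" and eqb: "b * (z + 1 / z) = c / z + z / c"
  shows "normal_form a b c z"
proof -
  define L where "L = z + 1 / z"
  have L: "L \<noteq> 0"
    using z by (simp add: L_def add_eq_0_iff2 nonzero_eq_divide_eq square_eq_1_iff2)
  have inv: "(x + 1 / x) ^ q = x + 1 / x" if "x ^ q = x \<or> x ^ q * x = 1" for x :: 'a
    using that
  proof
    assume "x ^ q * x = 1"
    from unit_circle_inverse(2)[OF this] show ?thesis
      by (simp add: add_power_q power_divide add.commute)
  qed (simp add: add_power_q power_divide)
  have "a ^ q * L = (a * L) ^ q" using inv[OF z(3)] by (simp add: power_mult_distrib L_def)
  also have "\<dots> = a * L" using inv[OF c(2)] eqa by (simp add: L_def)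
  finally have aq: "a ^ q = a" using L by simp
  have "c \<noteq> 1" using eqa a L by (auto simp: L_def)
  have "(a * z) * L = z * (a * L)" by (simp only: mult_ac)
  also have "\<dots> = b * L + c * L"
    unfolding L_def eqa eqb using z by (simp add: distrib_left add_ac mult.commute)
  finally have "(a * z) * L = (b + c) * L" by (simp only: distrib_right)
  hence az: "a * z = b + c" using L by simp
  have "(a * c) * L = c * (a * L)" by (simp only: mult_ac)
  also have "\<dots> = z * L + z * c * (b * L)"
    unfolding L_def eqa eqb using z c by (simp add: distrib_left add_ac mult.commute)
  finally have "(a * c) * L = (z * (1 + c * b)) * L" by (simp add: algebra_simps)
  hence "a * c = z * (1 + c * b)" using L by simp
  with az aq a c z \<open>c \<noteq> 1\<close> show ?thesis by (simp add: normal_form_def)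
qed

lemma permutes_field_iff_normal_form:
  assumes b: "b ^ q = b" "b \<noteq> 0" and a: "a \<noteq> 0" and ab: "a + b \<noteq> 1"
    and u: "u = (Q ^ (k + 1) - 1) div (Q - 1)"
  shows "permutes_field (monom 1 1 + monom b q + monom a u) \<longleftrightarrow>
    (\<exists>c z. normal_form a b c z \<and> (z ^ q = z \<and> c = z / z ^ Q \<or>
      (if even k then z ^ q = z else z ^ q * z = 1) \<and> c = z ^ Q * z))" (is "?L \<longleftrightarrow> ?R")
proof
  assume ?R
  thus ?L unfolding permutes_field_iff[OF b(1) u] using normal_form_sufficient[OF _ b(1)] by metis
next
  assume ?L
  hence I: "x1 = x2" if "x1 ^ q * x1 = 1" "x2 ^ q * x2 = 1"
    "num a b x1 * den a b x2 = num a b x2 * den a b x1" for x1 x2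
    using that unfolding permutes_field_iff[OF b(1) u] by blast
  define S where "S = 1 + b ^ 2 + a ^ q * a"
  have S: "S \<noteq> 0" unfolding S_def by (rule injective_double_point[OF b(1) a ab I])
  have "(b ^ 2) ^ q = b ^ 2" using b by (simp add: power2_eq_square power_mult_distrib)
  hence Sq: "S ^ q = S" by (simp add: S_def add_power_q power_mult_distrib mult.commute)
  have "((b / S) ^ 2) ^ q = (b / S) ^ 2"
    using b Sq by (simp add: power2_eq_square power_mult_distrib power_divide)
  then obtain y where y: "y ^ 2 + y = (b / S) ^ 2" "y ^ q = y \<or> y ^ q = y + 1"
    by (rule quadratic_root)
  \<comment> \<open>A singular member needs \<open>b * c ^ 2 + S * c + b = 0\<close>; scaling by
    \<open>S / b\<close> reduces this to the equation for \<open>y\<close>.\<close>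
  define c where "c = S / b * y"
  have "c * (c + S / b) = (S / b) ^ 2 * (y ^ 2 + y)"
  proof -
    have "e * y * (e * y + e) = e ^ 2 * (y ^ 2 + y)" for e
      by (simp add: power2_eq_square algebra_simps)
    thus ?thesis unfolding c_def .
  qed
  also have "\<dots> = 1" unfolding y(1) using S b by (simp add: power_divide)
  finally have cS: "c * (c + S / b) = 1" .
  hence c0: "c \<noteq> 0" by auto
  have c1: "c \<noteq> 1"
  proof
    assume "c = 1"
    with cS S b show False by simp
  qed
  have "b * (c * (c + S / b)) = b" by (simp add: cS)
  hence "b * c * c + c * S = b" using b by (simp add: algebra_simps)
  hence det: "(b + c) * (1 + c * b) = c * a * a ^ q"
    by (rule eq_transfer) (simp add: S_def power2_eq_square algebra_simps)
  have "c ^ q = S / b * y ^ q" using b Sq by (simp add: c_def power_mult_distrib power_divide)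
  \<comment> \<open>Conjugation fixes \<open>c\<close> or sends it to the other root
    \<open>1 / c\<close>: it lies in F_q or on the circle.\<close>
  hence "c ^ q = c \<or> c ^ q = c + S / b" using y(2) by (auto simp: c_def distrib_left add_divide_distrib)
  thus ?R
  proof
    assume cq: "c ^ q = c"
    obtain z where z: "normal_form a b c z" "z ^ q = z" "c = z / z ^ Q \<or> c = z ^ Q * z"
      using injective_singular_off_circle[OF b a c0 c1 cq det I] by blast
    have "even k" if "c = z ^ Q * z"
    proof (rule ccontr)
      assume "odd k"
      with normal_form_wrong_parity[OF z(1) that] z(2) I show False by metis
    qed
    with z show ?R by auto
  next
    assume "c ^ q = c + S / b"
    hence cq: "c ^ q * c = 1" using cS by (simp add: mult.commute)
    obtain z where z: "normal_form a b c z" "z ^ q * z = 1" "c = z ^ Q * z"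
      using injective_singular_on_circle[OF b(1) a c1 cq det I] by blast
    have "odd k"
    proof
      assume "even k"
      with normal_form_wrong_parity[OF z(1,3)] z(2) I show False by metis
    qed
    with z show ?R by auto
  qed
qed

section \<open>From the normal form to the parameter lambda\<close>

text \<open>Dividing by \<open>lam ^ Q\<close> leaves the powers of \<open>1 / lam\<close> with
  exponents 2 up to \<open>2 ^ l\<close>, which are the squared terms of the trace.\<close>

lemma sum_inverse_powers:
  assumes "lam \<noteq> (0 :: 'a)"
  shows "(\<Sum>i=1..l. lam ^ (Q - 2 ^ i)) = lam ^ Q * tr l (1 / lam) ^ 2"
proof -
  have "lam ^ (Q - 2 ^ i) = lam ^ Q * ((1 / lam) ^ 2 ^ i)" if "i \<in> {1..l}" for i
    using that assms by (simp add: Q_def power_diff power_divide)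
  hence "(\<Sum>i=1..l. lam ^ (Q - 2 ^ i)) = lam ^ Q * (\<Sum>i=1..l. (1 / lam) ^ 2 ^ i)"
    by (simp add: sum_distrib_left)
  also have "(\<Sum>i=1..l. (1 / lam) ^ 2 ^ i) = (\<Sum>i<l. ((1 / lam) ^ 2 ^ i) ^ 2)"
    by (intro sum.reindex_bij_witness[of _ Suc "\<lambda>i. i - 1"])
       (auto simp: power_mult[symmetric] mult.commute simp flip: power_Suc)
  also have "\<dots> = tr l (1 / lam) ^ 2"
    using sum_power_2[of "\<lambda>i. (1 / lam) ^ 2 ^ i" "{..<l}" 1] by (simp add: tr_def)
  finally show ?thesis .
qed

context
  fixes y z lam :: 'a
  assumes y: "y \<noteq> 0" "y \<noteq> 1" and z: "z = 1 + 1 / y" and lam: "lam = z + 1 / z"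
begin

lemma y_plus_1: "y + 1 \<noteq> 0"
  using y by (simp add: add_eq_0_iff2)

lemma z_eq: "z = (y + 1) / y"
  using y by (simp add: z add_divide_distrib)

text \<open>Writing \<open>z = 1 + 1 / y\<close> makes \<open>1 / lam\<close> equal to
  \<open>y ^ 2 + y\<close>, whose partial traces telescope.\<close>

lemma inverse_lam: "1 / lam = y ^ 2 + y" and lam_nonzero: "lam \<noteq> 0"
proof -
  have "lam = ((y + 1) * (y + 1) + y * y) / (y * (y + 1))"
    using y y_plus_1 by (simp add: lam z_eq add_frac_eq)
  also have "(y + 1) * (y + 1) + y * y = 1" by (simp add: algebra_simps)
  also have "y * (y + 1) = y ^ 2 + y" by (simp add: power2_eq_square algebra_simps)
  finally have "lam = 1 / (y ^ 2 + y)" .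
  moreover have "y ^ 2 + y \<noteq> 0"
    using y_plus_1 y by (simp add: power2_eq_square add_eq_0_iff2)
  ultimately show "1 / lam = y ^ 2 + y" "lam \<noteq> 0" by simp_all
qed

lemma tr_inverse_lam: "tr l (1 / lam) = y ^ Q + y"
  using tr_telescope[of l y] tr_power[of l y 1] by (simp add: inverse_lam tr_add Q_def)

context
  fixes a b eps :: 'a
  assumes b: "b * lam = lam ^ Q" and eps: "eps = 0 \<or> eps = 1"
begin

text \<open>As \<open>lam = (z + 1) ^ 2 / z\<close>, the sum times \<open>lam\<close> is
  \<open>z / z ^ Q\<close> plus its inverse. Adding \<open>lam ^ Q * lam\<close> exchanges this for
  \<open>z ^ Q * z\<close> plus its inverse.\<close>

lemma second_condition_iff:
  "a = eps * lam ^ Q + (\<Sum>i=1..l. lam ^ (Q - 2 ^ i)) \<longleftrightarrow>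
   a * lam = (if eps = 0 then z / z ^ Q + z ^ Q / z else z ^ Q * z + 1 / (z ^ Q * z))"
proof -
  have z0: "z \<noteq> 0" using y y_plus_1 by (simp add: z_eq)
  define w where "w = z + 1"
  have w: "y = 1 / w" using y by (simp add: w_def z)
  have w0: "w \<noteq> 0" using y w by auto
  have ww: "lam = w * w / z"
  proof -
    have "w * w = z * z + 1" by (simp add: w_def algebra_simps)
    thus ?thesis using z0 by (simp add: lam add_divide_distrib)
  qed
  have "y ^ Q + y = (w + w ^ Q) / (w * w ^ Q)"
    using w0 by (simp add: w power_divide add_frac_eq)
  also have "w + w ^ Q = z + z ^ Q" by (simp add: w_def add_power_Q add_ac)
  finally have "(y ^ Q + y) ^ 2 = (z + z ^ Q) ^ 2 / (w * w ^ Q) ^ 2" by (simp add: power_divide)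
  hence "lam * (lam ^ Q * tr l (1 / lam) ^ 2) = (z + z ^ Q) ^ 2 / (z * z ^ Q)"
    unfolding tr_inverse_lam using w0 z0
    by (simp add: ww power_divide power_mult_distrib power2_eq_square)
  also have "\<dots> = z / z ^ Q + z ^ Q / z"
    unfolding add_power_2 using z0 by (simp add: add_divide_distrib power2_eq_square)
  finally have sum: "(\<Sum>i=1..l. lam ^ (Q - 2 ^ i)) * lam = z / z ^ Q + z ^ Q / z"
    unfolding sum_inverse_powers[OF lam_nonzero] by (simp only: mult.commute)
  have prod: "lam ^ Q * lam = z ^ Q * z + 1 / (z ^ Q * z) + (z / z ^ Q + z ^ Q / z)"
    by (simp add: lam add_power_Q power_divide distrib_left distrib_right add_divide_distrib add_ac)
  have "a = eps * lam ^ Q + (\<Sum>i=1..l. lam ^ (Q - 2 ^ i)) \<longleftrightarrow>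
    a * lam = (eps * lam ^ Q + (\<Sum>i=1..l. lam ^ (Q - 2 ^ i))) * lam"
    using lam_nonzero by simp
  thus ?thesis unfolding distrib_right sum mult.assoc prod using eps
    by (auto simp: add_ac)
qed

text \<open>After division by \<open>lam ^ Q\<close>, numerator and denominator become
  \<open>(eps + T) ^ 2\<close> and \<open>eps + T\<close>.\<close>

lemma trace_argument:
  assumes a: "a = eps * lam ^ Q + (\<Sum>i=1..l. lam ^ (Q - 2 ^ i))" and ab: "a + b \<noteq> 1"
  shows "a / (a + b + 1) = eps + (y ^ Q + y)"
proof -
  define t T where "t = 1 / lam" and "T = tr l t"
  have a': "a = lam ^ Q * (eps + T ^ 2)"
    unfolding a sum_inverse_powers[OF lam_nonzero] by (simp add: T_def t_def algebra_simps)
  have b': "b = lam ^ Q * t" using b lam_nonzero by (simp add: t_def nonzero_eq_divide_eq)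
  have one: "1 = lam ^ Q * t ^ Q" using lam_nonzero by (simp add: t_def power_divide)
  have TT: "T ^ 2 + T = t ^ Q + t" using tr_telescope[of l t] by (simp add: T_def Q_def)
  have "a + b + 1 = a + lam ^ Q * (t ^ Q + t)"
    unfolding b' by (simp add: distrib_left add_ac flip: one)
  also have "\<dots> = lam ^ Q * (eps + T)" unfolding TT[symmetric] a' by (simp add: algebra_simps)
  finally have s: "a + b + 1 = lam ^ Q * (eps + T)" .
  have "a + b + 1 \<noteq> 0" using ab by (simp add: add_eq_0_iff2)
  hence nz: "eps + T \<noteq> 0" unfolding s by auto
  have "eps ^ 2 = eps" using eps by auto
  hence "eps + T ^ 2 = (eps + T) * (eps + T)" by (simp add: power2_eq_square algebra_simps)
  hence "a / (a + b + 1) = eps + T" unfolding s unfolding a'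
    using nz lam_nonzero by simp
  thus ?thesis by (simp add: T_def t_def tr_inverse_lam)
qed

text \<open>If \<open>y\<close> lies in F_q then so does \<open>T\<close> in F_2, and
  \<open>T ^ Q + T = 0\<close>. Otherwise \<open>T\<close> is a primitive cube root of unity and,
  \<open>l\<close> being odd, \<open>T ^ Q + T = 1\<close>. The trace of \<open>eps\<close> matters
  only for odd \<open>k\<close>.\<close>

lemma tr_zero_iff:
  assumes yq: "y ^ q = y \<or> y ^ q = y + 1"
  shows "tr k (eps + (y ^ Q + y)) = 0 \<longleftrightarrow>
    (if eps = 0 \<or> even k then z ^ q = z else z ^ q * z = 1)"
proof -
  define T where "T = tr k y"
  have "tr k (1 :: 'a) = of_nat k" by (simp add: tr_def)
  also have "\<dots> = (if even k then 0 else 1)" by (auto elim!: evenE oddE)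
  finally have one: "tr k (1 :: 'a) = (if even k then 0 else 1)" .
  have zero: "tr k (0 :: 'a) = 0" by (simp add: tr_def power_0_left)
  have split: "tr k (eps + (y ^ Q + y)) = tr k eps + (T ^ Q + T)"
    by (simp add: tr_add T_def Q_def tr_power)
  have TT: "T ^ 2 + T = y ^ q + y" using tr_telescope[of k y] by (simp add: T_def q_def)
  have z1: "z \<noteq> 1" "z \<noteq> 0" using y y_plus_1 by (simp_all add: z z_eq[unfolded z])
  show ?thesis using yq
  proof
    assume yq: "y ^ q = y"
    hence "T ^ 2 = T" using TT by (simp add: add_eq_0_iff2)
    hence "T ^ Q + T = 0" using square_fixed[of T] by auto
    moreover have zq: "z ^ q = z" by (simp add: z add_power_q power_divide yq)
    moreover have "z ^ q * z \<noteq> 1" using z1 by (simp add: zq square_eq_1_iff2)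
    ultimately show ?thesis using eps by (auto simp: split one zero)
  next
    assume yq: "y ^ q = y + 1"
    have "T ^ 2 = T + 1"
      using TT by (rule eq_transfer) (simp add: yq add_ac)
    hence "T ^ Q + T = 1" using frob_odd_of_cube_root[of T l] l_odd by (simp add: Q_def add_ac)
    moreover have "z ^ q = y / (y + 1)"
      using y y_plus_1 by (simp add: z_eq add_power_q power_divide yq)
    hence zq: "z ^ q * z = 1" using y y_plus_1 by (simp add: z_eq)
    moreover have "z ^ q \<noteq> z" using zq z1 by (auto simp: square_eq_1_iff2)
    ultimately show ?thesis using eps by (auto simp: split one zero)
  qed
qed

end

end

text \<open>The dictionary is \<open>lam = z + 1 / z\<close>, with \<open>eps\<close> telling
  whether \<open>c\<close> is \<open>z / z ^ Q\<close> or \<open>z ^ Q * z\<close>; the trace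
  condition decides between \<open>z\<close> in F_q and \<open>z\<close> on the circle.\<close>

lemma conditions_iff_normal_form:
  assumes a: "a \<noteq> 0" and b: "b \<noteq> 0" and ab: "a + b \<noteq> 1"
  shows "(\<exists>lam eps. lam ^ q = lam \<and> eps \<in> {0, 1} \<and> lam ^ (Q - 1) = b \<and>
      a = eps * lam ^ Q + (\<Sum>i=1..l. lam ^ (Q - 2 ^ i)) \<and> tr k (a / (a + b + 1)) = 0) \<longleftrightarrow>
    (\<exists>c z. normal_form a b c z \<and> (z ^ q = z \<and> c = z / z ^ Q \<or>
      (if even k then z ^ q = z else z ^ q * z = 1) \<and> c = z ^ Q * z))" (is "?L \<longleftrightarrow> ?R")
proof
  assume ?L
  then obtain lam eps where lam: "lam ^ q = lam" and eps: "eps = 0 \<or> eps = 1"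
    and blam: "lam ^ (Q - 1) = b" and alam: "a = eps * lam ^ Q + (\<Sum>i=1..l. lam ^ (Q - 2 ^ i))"
    and tr: "tr k (a / (a + b + 1)) = 0" by auto
  have lam0: "lam \<noteq> 0" using blam b Q_gt1 by (auto simp: power_0_left)
  have bQ: "b * lam = lam ^ Q" using Q_gt1 power_minus_mult[of Q lam] by (simp flip: blam)
  have "(1 / lam) ^ q = 1 / lam" by (simp add: power_divide lam)
  then obtain y where y: "y ^ 2 + y = 1 / lam" "y ^ q = y \<or> y ^ q = y + 1" by (rule quadratic_root)
  have y01: "y \<noteq> 0" "y \<noteq> 1" using y(1) lam0 by auto
  define z where "z = 1 + 1 / y"
  define L where "L = z + 1 / z"
  have "1 / L = y ^ 2 + y" by (rule inverse_lam[OF y01 z_def L_def])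
  hence lz: "lam = z + 1 / z" using y(1) by (simp add: L_def)
  note params = y01 z_def lz bQ eps
  define c where "c = (if eps = 0 then z / z ^ Q else z ^ Q * z)"
  have y1: "y + 1 \<noteq> 0" using y01 by (simp add: add_eq_0_iff2)
  have z01: "z \<noteq> 0" "z \<noteq> 1"
    using y01 y1 by (simp_all add: z_def add_divide_eq_iff add.commute)
  have par: "if eps = 0 \<or> even k then z ^ q = z else z ^ q * z = 1"
    using tr_zero_iff[OF params y(2)] tr unfolding trace_argument[OF params alam ab] by blast
  have zKU: "z ^ q = z \<or> z ^ q * z = 1" using par by metis
  have "z ^ q = z \<and> c = z / z ^ Q \<or>
    (if even k then z ^ q = z else z ^ q * z = 1) \<and> c = z ^ Q * z"
    using par by (cases "eps = 0") (simp_all add: c_def)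
  moreover have "normal_form a b c z"
  proof (rule normal_form_intro[OF z01 zKU a])
    show "c \<noteq> 0" using z01 by (simp add: c_def)
    have zq: "z ^ q = z \<or> z ^ q = 1 / z" using zKU unit_circle_inverse(2) by metis
    thus "c ^ q = c \<or> c ^ q * c = 1" using z01
      by (auto simp: c_def power_divide power_mult_distrib power_q_power_Q_commute[symmetric])
    show "a * (z + 1 / z) = c + 1 / c"
      using second_condition_iff[OF params, of a] alam by (simp add: c_def flip: lz)
    show "b * (z + 1 / z) = c / z + z / c"
      using bQ z01 by (simp add: c_def lz add_power_Q power_divide add.commute)
  qed
  ultimately show ?R by blast
next
  assume ?R
  then obtain c z where nf: "normal_form a b c z" and cz: "z ^ q = z \<and> c = z / z ^ Q \<or>
      (if even k then z ^ q = z else z ^ q * z = 1) \<and> c = z ^ Q * z" by blast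
  have z: "z \<noteq> 0" "z \<noteq> 1" using nf by (simp_all add: normal_form_def)
  define eps :: 'a where "eps = (if z ^ q = z \<and> c = z / z ^ Q then 0 else 1)"
  define y where "y = 1 / (z + 1)"
  define lam where "lam = z + 1 / z"
  have z1: "z + 1 \<noteq> 0" using z by (simp add: add_eq_0_iff2)
  have y: "y \<noteq> 0" "y \<noteq> 1" "z = 1 + 1 / y"
    using z z1 by (simp_all add: y_def add.commute)
  have zKU: "z ^ q = z \<or> z ^ q = 1 / z" using cz unit_circle_inverse(2) by metis
  have lamq: "lam ^ q = lam"
    using zKU by (auto simp: lam_def add_power_q power_divide add.commute)
  have eqs: "a * lam = c + 1 / c" "b * lam = c / z + z / c"
    using normal_form_equations[OF nf] by (simp_all add: lam_def)
  have bQ: "b * lam = lam ^ Q"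
    unfolding eqs(2) using cz z by (auto simp: lam_def add_power_Q power_divide add.commute)
  have eps: "eps = 0 \<or> eps = 1" by (simp add: eps_def)
  note params = y lam_def bQ eps
  have lam0: "lam \<noteq> 0" by (rule lam_nonzero[OF y lam_def])
  have "lam ^ (Q - 1) * lam = b * lam" using Q_gt1 bQ power_minus_mult[of Q lam] by simp
  hence "lam ^ (Q - 1) = b" using lam0 by simp
  moreover have alam: "a = eps * lam ^ Q + (\<Sum>i=1..l. lam ^ (Q - 2 ^ i))"
    unfolding second_condition_iff[OF params] eqs(1) using cz by (auto simp: eps_def)
  moreover have "tr k (a / (a + b + 1)) = 0"
  proof -
    have "(z + 1) ^ q = z + 1 \<or> (z + 1) ^ q = (z + 1) / z"
      using zKU z by (auto simp: add_power_q add_divide_distrib add.commute)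
    hence "y ^ q = y \<or> y ^ q = z / (z + 1)" by (auto simp: y_def power_divide)
    moreover have "z / (z + 1) = y + 1"
      using add_divide_distrib[of 1 "z + 1" "z + 1"] z1 by (simp add: y_def add_ac)
    ultimately have "y ^ q = y \<or> y ^ q = y + 1" by simp
    note * = tr_zero_iff[OF params this]
    have "if eps = 0 \<or> even k then z ^ q = z else z ^ q * z = 1"
    proof (cases "eps = 0")
      case True
      thus ?thesis by (simp add: eps_def split: if_splits)
    next
      case False
      hence "\<not> (z ^ q = z \<and> c = z / z ^ Q)" unfolding eps_def by argo
      hence "if even k then z ^ q = z else z ^ q * z = 1" using cz by blast
      with False show ?thesis by simp
    qed
    thus ?thesis unfolding trace_argument[OF params alam ab] * .
  qed
  ultimately show ?L using lamq eps by blast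
qed

end

theorem corollary9p12:
  fixes k l q Q u :: nat
    and Fq :: "'a::{field,finite} set"
    and a b :: 'a
  assumes "k > 0" and "l > 0" and "gcd (2 * k) l = 1"
    and "q = 2 ^ k" and "Q = 2 ^ l" and "u = (Q ^ (k + 1) - 1) div (Q - 1)"
    and "card (UNIV :: 'a set) = q ^ 2"
    and "is_subfield Fq" and "card Fq = q"
    and "a \<noteq> 0"
    and "b \<in> Fq" and "b \<noteq> 0"
    and "a + b \<noteq> 1"
  shows "permutes_field (monom 1 1 + monom b q + monom a u) \<longleftrightarrow>
    (\<exists>lam\<in>Fq. \<exists>eps\<in>{0, 1}.
        lam ^ (Q - 1) = b \<and>
        a = eps * lam ^ Q + (\<Sum>i=1..l. lam ^ (Q - 2 ^ i)) \<and>
        poly (trace_poly k) (a / (a + b + 1)) = 0)"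
proof -
  interpret quadratic_extension k l q Q "TYPE('a)"
    using assms by unfold_locales (simp_all add: coprime_iff_gcd_eq_1)
  \<comment> \<open>A subfield of order \<open>q\<close> consists of roots of
    \<open>X ^ q - X\<close>, and there are at most \<open>q\<close> of them.\<close>
  have Fq: "Fq = {x. x ^ q = x}"
  proof (rule card_seteq)
    show "Fq \<subseteq> {x. x ^ q = x}"
      using is_subfield_power_card[OF assms(8)] assms(9) by auto
    show "card {x :: 'a. x ^ q = x} \<le> card Fq"
      using card_fixed_q assms(9) by simp
  qed simp
  have "b ^ q = b" using assms(11) by (simp add: Fq)
  have "lam \<in> Fq \<longleftrightarrow> lam ^ q = lam" for lam by (simp add: Fq)
  thus ?thesis
    unfolding permutes_field_iff_normal_form[OF \<open>b ^ q = b\<close> assms(12,10,13,6)]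
      conditions_iff_normal_form[OF assms(10,12,13), symmetric] poly_trace_poly
    by blast
qed

end
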